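(* There exists $n_0$ such that for every integer $n\geq n_0$, in every 2-coloring of the edges of $K_{n,n}$ there exists a monochromatic cycle on at least $2\lfloor n/2\rfloor$ vertices. Furthermore, this is best possible: for every such $n$ there exists a 2-coloring of the edges of $K_{n,n}$ in which the longest monochromatic cycle has exactly $2\lfloor n/2\rfloor$ vertices.
   Context: $K_{n,n}$ is the complete bipartite graph with both parts of size $n$. A 2-coloring of the edges of a graph $G$ means a pair of edge sets $E_R$ (red edges) and $E_B$ (blue edges) with $E(G)=E_R\cup E_B$; it is not required that $E_R\cap E_B=\emptyset$, so an edge may have both colors. A cycle is monochromatic if all of its edges lie in $E_R$ or all of its edges lie in $E_B$. *)

theory Defs
  imports Main
begin

text \<open>
  Undirected simple graphs are given by their edge sets, an edge being the two-element set of its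
  end points. The two parts of the complete bipartite graph are tagged by \<open>Inl\<close> and \<open>Inr\<close>, so
  they are disjoint.
\<close>

definition complete_bipartite_edges :: "nat \<Rightarrow> nat \<Rightarrow> (nat + nat) set set" where
  "complete_bipartite_edges m n = {{Inl i, Inr j} | i j. i < m \<and> j < n}"

text \<open>The colour classes need not be disjoint: an edge may carry both colours.\<close>

definition two_edge_coloring :: "'a set set \<Rightarrow> 'a set set \<Rightarrow> 'a set set \<Rightarrow> bool" where
  "two_edge_coloring E E\<^sub>R E\<^sub>B \<longleftrightarrow> E = E\<^sub>R \<union> E\<^sub>B"

text \<open>
  A cycle on \<open>k \<ge> 3\<close> vertices is represented by the list of its \<open>k\<close> distinct vertices in cyclic
  order, the first vertex not being repeated at the end; thus \<open>length vs\<close> is its number of vertices.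
\<close>

definition cycle_edges :: "'a list \<Rightarrow> 'a set set" where
  "cycle_edges vs = {{vs ! i, vs ! (Suc i mod length vs)} | i. i < length vs}"

definition is_cycle :: "'a set set \<Rightarrow> 'a list \<Rightarrow> bool" where
  "is_cycle E vs \<longleftrightarrow> 3 \<le> length vs \<and> distinct vs \<and> cycle_edges vs \<subseteq> E"

definition monochromatic_cycle :: "'a set set \<Rightarrow> 'a set set \<Rightarrow> 'a list \<Rightarrow> bool" where
  "monochromatic_cycle E\<^sub>R E\<^sub>B vs \<longleftrightarrow> is_cycle E\<^sub>R vs \<or> is_cycle E\<^sub>B vs"

end

theory Submission
  imports Defs
begin

text \<open>
  It suffices to treat \<open>K\<^bsub>2m,2m\<^esub>\<close> with disjoint colour classes. Suppose that no monochromatic cycle has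
  length at least \<open>2m\<close>, and take a longest cycle that is the union of a red and a blue path with common
  end points \<open>x\<close> and \<open>y\<close>. The edges between such a cycle and the vertices outside it are severely
  restricted by maximality, which forces the cycle to be Hamiltonian. Then there are two cases.

  If \<open>x\<close> and \<open>y\<close> lie on opposite sides, the longer path, say the red one, has \<open>2m + 2t\<close> vertices
  \<open>p\<^sub>0, p\<^sub>1, \<dots>\<close>. All its chords that close a cycle of length at least \<open>2m\<close> are blue, and the zigzag
  \<open>p\<^sub>0, p\<^bsub>2m+1\<^esub>, p\<^sub>2, p\<^bsub>2m+3\<^esub>, \<dots>\<close> of \<open>2t\<close> vertices along these chords closes the blue path to a blue cycle
  of length exactly \<open>2m\<close>.

  If \<open>x\<close> and \<open>y\<close> lie on the same side, vertices can be shifted from the longer path to the shorter one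
  until both have \<open>2m - 1\<close> inner vertices. From both ends of the two paths one then grows vertex sets
  \<open>A\<^sub>1, A\<^sub>2, B\<^sub>1, B\<^sub>2\<close> such that \<open>A\<^sub>i\<close> and \<open>B\<^sub>j\<close> are completely joined in red for \<open>i = j\<close> and in blue for
  \<open>i \<noteq> j\<close>, until one of these complete bipartite graphs contains a cycle of length \<open>2m\<close>.
\<close>

subsection \<open>Paths and cycles\<close>

definition path :: "('v \<Rightarrow> 'v \<Rightarrow> bool) \<Rightarrow> 'v list \<Rightarrow> bool" where
  "path f xs \<longleftrightarrow> distinct xs \<and> successively f xs"

definition cyc :: "('v \<Rightarrow> 'v \<Rightarrow> bool) \<Rightarrow> 'v list \<Rightarrow> bool" where
  "cyc f xs \<longleftrightarrow> 3 \<le> length xs \<and> path f xs \<and> f (last xs) (hd xs)"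

lemma path_Nil [simp]: "path f []"
  by (simp add: path_def)

lemma path_Cons:
  "path f (x # xs) \<longleftrightarrow> x \<notin> set xs \<and> path f xs \<and> (xs = [] \<or> f x (hd xs))"
  by (auto simp: path_def successively_Cons)

lemma path_append:
  "path f (xs @ ys) \<longleftrightarrow> path f xs \<and> path f ys \<and> set xs \<inter> set ys = {} \<and>
     (xs = [] \<or> ys = [] \<or> f (last xs) (hd ys))"
  by (auto simp: path_def successively_append_iff)

lemma path_extend:
  assumes "path f xs" "xs \<noteq> []" "a \<notin> set xs" "b \<notin> set xs" "a \<noteq> b"
    and "f a (hd xs)" "f (last xs) b"
  shows "path f (a # xs @ [b])"
  using assms by (auto simp: path_Cons path_append)

lemma path_rev:
  assumes "symp f"
  shows "path f (rev xs) \<longleftrightarrow> path f xs"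
proof -
  have "(\<lambda>x y. f y x) = f"
    using assms by (auto simp: fun_eq_iff symp_def)
  then show ?thesis
    by (metis path_def distinct_rev successively_rev)
qed

lemma path_tl_butlast:
  assumes "path f xs" "3 \<le> length xs"
  obtains ys where "xs = hd xs # ys @ [last xs]" "path f ys" "ys \<noteq> []"
    "f (hd xs) (hd ys)" "f (last ys) (last xs)" "hd xs \<noteq> last xs"
    "hd xs \<notin> set ys" "last xs \<notin> set ys"
proof -
  obtain a zs where a: "xs = a # zs"
    using assms(2) by (cases xs) auto
  moreover obtain ys b where "zs = ys @ [b]"
    using assms(2) a by (cases zs rule: rev_cases) auto
  ultimately have eq: "xs = a # ys @ [b]" by simp
  have "ys \<noteq> []" using assms(2) eq by auto
  then show ?thesis
    using that[of ys] assms(1) eq by (auto simp: path_Cons path_append)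
qed

lemma cyc_rotate:
  assumes "cyc f (xs @ ys)"
  shows "cyc f (ys @ xs)"
  using assms by (cases "xs = []"; cases "ys = []") (auto simp: cyc_def path_append)

lemma cyc_append:
  assumes "path f xs" "path f ys" "xs \<noteq> []" "ys \<noteq> []" "set xs \<inter> set ys = {}"
    and "f (last xs) (hd ys)" "f (last ys) (hd xs)" "3 \<le> length (xs @ ys)"
  shows "cyc f (xs @ ys)"
  using assms by (simp add: cyc_def path_append)

lemma complete_path:
  assumes "finite S" "finite T" "S \<inter> T = {}" "symp f"
    and "\<And>s t. s \<in> S \<Longrightarrow> t \<in> T \<Longrightarrow> f s t"
    and "s \<in> S" "s' \<in> S" "s \<noteq> s'" "1 \<le> k" "k \<le> card T" "k < card S"
  shows "\<exists>xs. path f (s # xs @ [s']) \<and> set xs \<subseteq> S \<union> T \<and> length xs = 2 * k - 1"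
  using assms(9,1-3,5-8,10-)
proof (induction k arbitrary: S T s rule: dec_induct)
  case base
  then obtain t where "t \<in> T" by fastforce
  with base show ?case
    using \<open>symp f\<close> by (intro exI[of _ "[t]"]) (auto simp: path_Cons symp_def)
next
  case (step k)
  obtain t where t: "t \<in> T"
    using step.prems by fastforce
  have "card (S - {s, s'}) > 0"
    using step by (simp add: card_Diff_subset)
  then obtain z where z: "z \<in> S" "z \<noteq> s" "z \<noteq> s'"
    by (metis DiffE card_gt_0_iff ex_in_conv insertCI)
  have "\<exists>xs. path f (z # xs @ [s']) \<and> set xs \<subseteq> (S - {s}) \<union> (T - {t}) \<and> length xs = 2 * k - 1"
    by (rule step.IH) (use step.prems t z in \<open>auto simp: card_Diff_singleton\<close>)
  then obtain xs where xs: "path f (z # xs @ [s'])" "set xs \<subseteq> (S - {s}) \<union> (T - {t})"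
    "length xs = 2 * k - 1"
    by blast
  have "path f (s # (t # z # xs) @ [s'])"
    using xs step.prems t z \<open>symp f\<close> by (auto simp: path_Cons symp_def)
  moreover have "length (t # z # xs) = 2 * Suc k - 1"
    using xs step.hyps by simp
  ultimately show ?case
    using xs t z by (intro exI[of _ "t # z # xs"]) auto
qed

text \<open>One vertex \<open>t\<close> is kept aside to join the two ends of a path from
  \<open>complete_path\<close>.\<close>

lemma complete_cycle:
  assumes "finite S" "finite T" "S \<inter> T = {}" "symp f"
    and "\<And>s t. s \<in> S \<Longrightarrow> t \<in> T \<Longrightarrow> f s t"
    and "2 \<le> k" "k \<le> card S" "k \<le> card T"
  obtains xs where "cyc f xs" "length xs = 2 * k"
proof -
  obtain s s' where s: "s \<in> S" "s' \<in> S" "s \<noteq> s'"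
    using assms(6,7) by (metis card_le_Suc0_iff_eq assms(1) not_less_eq_eq numeral_2_eq_2 order_trans)
  obtain t where t: "t \<in> T"
    using assms(6,8) by fastforce
  have "\<exists>xs. path f (s # xs @ [s']) \<and> set xs \<subseteq> S \<union> (T - {t}) \<and> length xs = 2 * (k - 1) - 1"
    by (rule complete_path) (use assms s t in \<open>auto simp: card_Diff_singleton\<close>)
  then obtain xs where xs: "path f (s # xs @ [s'])" "set xs \<subseteq> S \<union> (T - {t})" "length xs = 2 * (k - 1) - 1"
    by blast
  have "cyc f (t # s # xs @ [s'])"
    using xs s t assms by (auto simp: cyc_def path_Cons symp_def)
  moreover have "length (t # s # xs @ [s']) = 2 * k"
    using xs assms(6) by simp
  ultimately show thesis using that by blast
qed

text \<open>These are the properties of a supposed counterexample, with \<open>f\<close> read as red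
  and \<open>g\<close> as blue; they are refuted in \<open>contradiction\<close>. Colours and sides
  enter symmetrically, so \<open>swap_colours\<close> and \<open>swap_sides\<close> spare the
  mirrored arguments.\<close>

locale bicoloured =
  fixes A B :: "'v set" and f g :: "'v \<Rightarrow> 'v \<Rightarrow> bool" and m :: nat
  assumes card_A: "card A = 2 * m" and card_B: "card B = 2 * m" and m_ge: "3 \<le> m"
    and A_B: "A \<inter> B = {}"
    and f_cross: "f u v \<Longrightarrow> u \<in> A \<and> v \<in> B \<or> u \<in> B \<and> v \<in> A"
    and g_cross: "g u v \<Longrightarrow> u \<in> A \<and> v \<in> B \<or> u \<in> B \<and> v \<in> A"
    and f_sym: "symp f" and g_sym: "symp g"
    and g_iff: "a \<in> A \<Longrightarrow> b \<in> B \<Longrightarrow> g a b \<longleftrightarrow> \<not> f a b"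
    and f_short: "cyc f xs \<Longrightarrow> length xs < 2 * m"
    and g_short: "cyc g xs \<Longrightarrow> length xs < 2 * m"
begin

lemma finite_A [simp]: "finite A" and finite_B [simp]: "finite B"
  by (rule card_ge_0_finite, use card_A card_B m_ge in linarith)+

lemma f_commute: "f u v \<longleftrightarrow> f v u" and g_commute: "g u v \<longleftrightarrow> g v u"
  using f_sym g_sym by (auto simp: symp_def)

lemma f_g_excl: "\<not> (f u v \<and> g u v)"
  using f_cross g_iff f_commute g_commute by blast

lemma swap_colours: "bicoloured A B g f m"
  by unfold_locales
    (use card_A card_B m_ge A_B f_cross g_cross f_sym g_sym g_iff f_short g_short in auto)

lemma swap_sides: "bicoloured B A f g m"
proof (unfold_locales, goal_cases)
  case (5 u v)
  then show ?case using f_cross by blast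
next
  case (6 u v)
  then show ?case using g_cross by blast
next
  case (9 b a)
  then show ?case using g_iff f_commute g_commute by blast
qed (use card_A card_B m_ge A_B f_sym g_sym f_short g_short in auto)

lemma no_complete:
  assumes "S \<subseteq> A" "T \<subseteq> B" "m \<le> card S" "m \<le> card T"
    and "\<And>s t. s \<in> S \<Longrightarrow> t \<in> T \<Longrightarrow> f s t"
  shows False
proof -
  have "finite S" "finite T" "S \<inter> T = {}"
    using assms(1,2) A_B finite_subset[OF _ finite_A] finite_subset[OF _ finite_B] by auto
  then obtain xs where "cyc f xs" "length xs = 2 * m"
    using complete_cycle[of S T f m] assms m_ge f_sym by auto
  then show False using f_short by fastforce
qed

end

subsection \<open>Growing split colourings\<close>

text \<open>
  The case \<open>k = 0\<close> is a Hamiltonian cycle made of a red path through \<open>P\<close> and a blue path through \<open>Q\<close> between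
  the vertices of \<open>A1 = {x}\<close> and \<open>A2 = {y}\<close>. Absorbing the four end vertices of \<open>P\<close> and \<open>Q\<close> exchanges
  the roles of the two sides.
\<close>

locale cluster = bicoloured +
  fixes A1 A2 B1 B2 :: "'a set" and P Q :: "'a list" and k :: nat
  assumes subs: "A1 \<subseteq> A" "A2 \<subseteq> A" "B1 \<subseteq> B" "B2 \<subseteq> B"
    and disj: "A1 \<inter> A2 = {}" "B1 \<inter> B2 = {}"
      "set P \<inter> (A1 \<union> A2 \<union> B1 \<union> B2) = {}" "set Q \<inter> (A1 \<union> A2 \<union> B1 \<union> B2) = {}" "set P \<inter> set Q = {}"
    and P: "path f P" and Q: "path g Q"
    and k_less: "k < m"
    and cards: "card A1 = Suc k" "card A2 = Suc k" "card B1 = k" "card B2 = k"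
    and len: "length P = 2 * (m - k) - 1" "length Q = 2 * (m - k) - 1"
    and ends: "hd P \<in> B" "last P \<in> B" "hd Q \<in> B" "last Q \<in> B"
    and f11: "a \<in> A1 \<Longrightarrow> b \<in> B1 \<Longrightarrow> f a b" and f22: "a \<in> A2 \<Longrightarrow> b \<in> B2 \<Longrightarrow> f a b"
    and g12: "a \<in> A1 \<Longrightarrow> b \<in> B2 \<Longrightarrow> g a b" and g21: "a \<in> A2 \<Longrightarrow> b \<in> B1 \<Longrightarrow> g a b"
    and attach: "\<exists>a\<in>A1. f a (hd P)" "\<exists>a\<in>A2. f a (last P)" "\<exists>a\<in>A1. g a (hd Q)" "\<exists>a\<in>A2. g a (last Q)"
begin

lemma P_ne: "P \<noteq> []" and Q_ne: "Q \<noteq> []"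
  using len k_less by auto

lemma fin: "finite A1" "finite A2" "finite B1" "finite B2"
  using subs finite_A finite_B finite_subset by blast+

text \<open>The paths are reversed because their first vertices attach to \<open>A1\<close> and
  their last vertices to \<open>A2\<close>.\<close>

lemma swap_indices: "cluster A B f g m A2 A1 B2 B1 (rev P) (rev Q) k"
proof (intro cluster.intro cluster_axioms.intro)
  show "bicoloured A B f g m" by (rule bicoloured_axioms)
  show "path f (rev P)" "path g (rev Q)"
    using P Q path_rev[OF f_sym] path_rev[OF g_sym] by auto
  show "set (rev P) \<inter> (A2 \<union> A1 \<union> B2 \<union> B1) = {}" "set (rev Q) \<inter> (A2 \<union> A1 \<union> B2 \<union> B1) = {}"
    "A2 \<inter> A1 = {}" "B2 \<inter> B1 = {}" "set (rev P) \<inter> set (rev Q) = {}"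
    using disj by auto
qed (auto simp: hd_rev last_rev subs k_less cards len ends attach f11 f22 g12 g21)

text \<open>Red joins equal indices and blue different ones, so exchanging the colours exchanges
  \<open>B1\<close> with \<open>B2\<close>.\<close>

lemma swap_cluster_colours: "cluster A B g f m A1 A2 B2 B1 Q P k"
proof (intro cluster.intro cluster_axioms.intro)
  show "bicoloured A B g f m" by (rule swap_colours)
  show "set Q \<inter> (A1 \<union> A2 \<union> B2 \<union> B1) = {}" "set P \<inter> (A1 \<union> A2 \<union> B2 \<union> B1) = {}"
    "B2 \<inter> B1 = {}" "set Q \<inter> set P = {}"
    using disj by auto
qed (auto simp: subs disj P Q k_less cards len ends attach f11 f22 g12 g21)

lemma ends_in: "hd P \<in> set P" "last P \<in> set P" "hd Q \<in> set Q" "last Q \<in> set Q"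
  using P_ne Q_ne by auto

text \<open>Two different vertices would be joined by a red path through all
  \<open>2 * k + 1\<close> vertices of \<open>A2\<close> and \<open>B2\<close>, which together with
  \<open>P\<close> closes a red cycle of length \<open>2 * m\<close>.\<close>

lemma f_last_unique:
  assumes y: "y \<in> A2" "f (hd P) y" and y': "y' \<in> A2" "f (last P) y'"
  shows "y = y'"
proof (rule ccontr)
  assume ne: "y \<noteq> y'"
  have "card {y, y'} \<le> card A2"
    using y y' fin by (intro card_mono) auto
  then have k: "1 \<le> k" using ne cards by simp
  have "A2 \<inter> B2 = {}" using subs A_B by blast
  then obtain xs where xs: "path f (y' # xs @ [y])" "set xs \<subseteq> A2 \<union> B2" "length xs = 2 * k - 1"
    using complete_path[of A2 B2 f y' y k] fin f_sym f22 y y' ne k cards by auto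
  have "cyc f (P @ y' # xs @ [y])"
  proof (rule cyc_append)
    show "set P \<inter> set (y' # xs @ [y]) = {}"
      using xs(2) y y' disj(3) by auto
    show "f (last (y' # xs @ [y])) (hd P)"
      using y f_commute by simp
    show "3 \<le> length (P @ y' # xs @ [y])"
      using P_ne by (cases P) auto
  qed (use P P_ne xs y' in auto)
  moreover have "length (P @ y' # xs @ [y]) = 2 * m"
    using xs len k k_less by simp
  ultimately show False using f_short by fastforce
qed

text \<open>Otherwise \<open>b\<close> closes a blue cycle: through \<open>A1\<close> and
  \<open>B2\<close> to the start of \<open>Q\<close>, along \<open>Q\<close>, and back through
  \<open>A2\<close> and \<open>B1\<close>. A detour between different vertices has
  \<open>2 * k + 1\<close> vertices, and one such detour makes the cycle too long.\<close>

lemma g_both: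
  assumes b: "b \<in> B" "b \<notin> set Q \<union> B1 \<union> B2" and x1: "x1 \<in> A1" "g b x1" and y1: "y1 \<in> A2" "g b y1"
    and x: "x \<in> A1" "g x (hd Q)" and y: "y \<in> A2" "g y (last Q)"
  shows "x1 = x \<and> y1 = y"
proof (rule ccontr)
  assume ne: "\<not> (x1 = x \<and> y1 = y)"
  have k: "1 \<le> k"
  proof -
    have "card {x1, x} \<le> card A1" "card {y1, y} \<le> card A2"
      using x y x1 y1 fin by (intro card_mono; auto)+
    then show ?thesis using ne cards by (auto split: if_splits simp: card_insert_if)
  qed
  have "\<exists>xs. path g xs \<and> hd xs = s \<and> last xs = s' \<and> xs \<noteq> [] \<and> set xs \<subseteq> S \<union> T
      \<and> length xs = (if s = s' then 1 else 2 * k + 1)"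
    if "s \<in> S" "s' \<in> S" "S \<inter> T = {}" "finite S" "finite T"  "\<And>a b. a \<in> S \<Longrightarrow> b \<in> T \<Longrightarrow> g a b"
      "card S = Suc k" "card T = k" for S T s s'
  proof (cases "s = s'")
    case True
    then show ?thesis using that by (intro exI[of _ "[s]"]) (auto simp: path_Cons)
  next
    case False
    have "\<exists>xs. path g (s # xs @ [s']) \<and> set xs \<subseteq> S \<union> T \<and> length xs = 2 * k - 1"
      by (rule complete_path) (use that False k g_sym in auto)
    then obtain xs where "path g (s # xs @ [s'])" "set xs \<subseteq> S \<union> T" "length xs = 2 * k - 1"
      by blast
    then show ?thesis
      using that False k by (intro exI[of _ "s # xs @ [s']"]) auto
  qed note * = this
  obtain xs where xs: "path g xs" "hd xs = x1" "last xs = x" "xs \<noteq> []" "set xs \<subseteq> A1 \<union> B2"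
    "length xs = (if x1 = x then 1 else 2 * k + 1)"
    using *[of x1 A1 x B2] x x1 fin cards g12 subs A_B by blast
  obtain ys where ys: "path g ys" "hd ys = y" "last ys = y1" "ys \<noteq> []" "set ys \<subseteq> A2 \<union> B1"
    "length ys = (if y = y1 then 1 else 2 * k + 1)"
    using *[of y A2 y1 B1] y y1 fin cards g21 subs A_B by blast
  have "b \<notin> A1 \<union> A2" using b subs A_B by blast
  moreover have "set xs \<inter> set ys = {}"
  proof -
    have "A1 \<inter> B1 = {}" "B2 \<inter> A2 = {}" using subs A_B by blast+
    then have "(A1 \<union> B2) \<inter> (A2 \<union> B1) = {}" using disj(1,2) by blast
    then show ?thesis using xs(5) ys(5) by blast
  qed
  moreover have "set Q \<inter> (set xs \<union> set ys) = {}"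
    using xs(5) ys(5) disj by blast
  moreover have "b \<notin> set xs" "b \<notin> set ys" "b \<notin> set Q"
    using b xs(5) ys(5) \<open>b \<notin> A1 \<union> A2\<close> by blast+
  moreover have len_pos: "1 \<le> length xs" "1 \<le> length ys" "1 \<le> length Q"
    using xs(4) ys(4) Q_ne by (simp_all add: Suc_le_eq)
  moreover have "g (last Q) (hd ys)" "g (last ys) b" "g b (hd xs)" "g (last xs) (hd Q)"
    using xs ys x y x1 y1 g_commute by auto
  ultimately have "cyc g (xs @ Q @ ys @ [b])"
    using xs(1,4) ys(1,4) Q Q_ne len_pos
    by (intro cyc_append) (auto simp: path_append path_Cons)
  moreover have "length (xs @ Q @ ys @ [b]) \<ge> 2 * m"
    using xs(6) ys(6) ne len k_less by (auto split: if_splits)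
  ultimately show False using g_short by fastforce
qed

text \<open>A red neighbour \<open>y\<close> of \<open>hd P\<close> in \<open>A2\<close> is excluded
  in stages: \<open>k = 0\<close> by a cycle through \<open>P\<close> and \<open>y\<close>, larger
  \<open>k\<close> except 1 by the rigidity in \<open>f_last_unique\<close> and
  \<open>g_both\<close>, and \<open>k = 1\<close> by explicit red cycles.\<close>

lemma hd_P_A2:
  assumes y: "y \<in> A2"
  shows "g (hd P) y"
proof (rule ccontr)
  assume "\<not> g (hd P) y"
  then have fy: "f (hd P) y"
    using y subs(2) ends(1) g_iff f_commute g_commute by blast
  interpret i: cluster A B f g m A2 A1 B2 B1 "rev P" "rev Q" k by (rule swap_indices)
  interpret c: cluster A B g f m A1 A2 B2 B1 Q P k by (rule swap_cluster_colours)
  have last_y: "y' = y" if "y' \<in> A2" "f (last P) y'" for y'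
    using f_last_unique[OF y fy that] by simp
  obtain y' where "y' \<in> A2" "f y' (last P)" using attach(2) by blast
  then have y_last: "f (last P) y" using last_y f_commute by blast
  have not_f: "g b a" if "a \<in> A1 \<union> A2" "b \<in> B" "\<not> f b a" for a b
    using that subs g_iff f_commute g_commute by blast
  have "k \<noteq> 0"
  proof
    assume k: "k = 0"
    have "y \<notin> set P" using y disj by blast
    then have "cyc f (P @ [y])"
      using P P_ne fy y_last f_commute len k m_ge
      by (intro cyc_append) (auto simp: path_Cons)
    moreover have "length (P @ [y]) = 2 * m" using len k m_ge by simp
    ultimately show False using f_short by fastforce
  qed
  obtain z where z: "z \<in> A2" "z \<noteq> y"
  proof -
    have "\<not> A2 \<subseteq> {y}"
      using cards(2) \<open>k \<noteq> 0\<close> card_mono[of "{y}" A2] by auto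
    then show ?thesis using that by blast
  qed
  have g_P_z: "g (hd P) z'" "g (last P) z'" if "z' \<in> A2" "z' \<noteq> y" for z'
    using that not_f ends f_last_unique[OF that(1) _ y y_last] last_y by blast+
  have P_out: "hd P \<notin> set Q \<union> B1 \<union> B2" "last P \<notin> set Q \<union> B1 \<union> B2"
    using ends_in disj by blast+
  obtain x where x: "x \<in> A1" "g x (hd Q)" using attach by blast
  obtain w where w: "w \<in> A2" "g w (last Q)" using attach by blast
  obtain x0 where x0: "x0 \<in> A1" "f (hd P) x0" using attach f_commute by blast
  \<comment> \<open>Were \<open>hd P\<close> red to all of \<open>A1\<close>, then
    \<open>last P\<close> would have a blue neighbour in \<open>A1\<close> other than
    \<open>x\<close> and the blue neighbour \<open>z\<close> in \<open>A2\<close>, against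
    \<open>g_both\<close>.\<close>
  have "\<exists>x1\<in>A1. g (hd P) x1"
  proof (rule ccontr)
    assume none: "\<not> (\<exists>x1\<in>A1. g (hd P) x1)"
    then have all: "f (hd P) a" if "a \<in> A1" for a
      using that not_f ends by blast
    have "\<not> A1 \<subseteq> {x}"
      using cards(1) \<open>k \<noteq> 0\<close> card_mono[of "{x}" A1] by auto
    then obtain x1 where x1: "x1 \<in> A1" "x1 \<noteq> x" by blast
    have "\<not> f (last P) x1"
    proof
      assume *: "f (last P) x1"
      have "x = x1"
        using i.f_last_unique[of x1 x] x1 * x all[OF x(1)] by (simp add: hd_rev last_rev P_ne)
      then show False using x1 by simp
    qed
    then have "g (last P) x1" using x1 not_f ends by blast
    then show False
      using g_both[OF ends(2) P_out(2) x1(1) _ z(1) g_P_z(2)[OF z] x w] x1 by blast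
  qed
  then obtain x1 where x1: "x1 \<in> A1" "g (hd P) x1" by blast
  have both: "x1 = a \<and> z' = b" if "a \<in> A1" "g a (hd Q)" "b \<in> A2" "g b (last Q)" "z' \<in> A2" "z' \<noteq> y" for a b z'
    using g_both[OF ends(1) P_out(1) x1 that(5) g_P_z(1)[OF that(5,6)] that(1-4)] .
  \<comment> \<open>Every vertex of \<open>A2\<close> other than \<open>y\<close> must be the one
    attaching \<open>last Q\<close>, so there is only one.\<close>
  have A2: "A2 = {y, z}"
    using both[OF x w] z y by blast
  then have "card A2 = 2" using z by simp
  then have "k = 1" using cards by simp
  have f_hdQ: "f (hd Q) x0"
  proof (rule ccontr)
    assume "\<not> f (hd Q) x0"
    then have "g x0 (hd Q)" using x0 not_f ends g_commute by blast
    then have "x1 = x0" using both[OF x0(1) _ w z] by blast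
    then show False using f_g_excl x0(2) x1(2) by blast
  qed
  have x0_last: "f (last P) x0"
  proof (rule ccontr)
    assume "\<not> f (last P) x0"
    then have "g (last P) x0" using x0 not_f ends by blast
    then have "x0 = x"
      using g_both[OF ends(2) P_out(2) x0(1) _ z(1) g_P_z(2)[OF z] x w] by blast
    moreover have "x1 = x" using both[OF x w z] by blast
    ultimately show False using f_g_excl x0(2) x1(2) by blast
  qed
  have Q_out: "hd Q \<notin> set P \<union> A1 \<union> A2" "hd Q \<notin> B2"
    using ends_in disj by blast+
  have xy: "x0 \<notin> set P" "y \<notin> set P" "x0 \<noteq> y" "z \<notin> set P" "x0 \<noteq> z"
    using x0 y z disj by blast+
  have "\<not> f (hd Q) y"
  proof
    assume *: "f (hd Q) y"
    have "cyc f (P @ [y, hd Q, x0])"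
      using P P_ne * f_hdQ y_last x0 f_commute xy Q_out x0 y
      by (intro cyc_append) (auto simp: path_Cons)
    moreover have "length (P @ [y, hd Q, x0]) = 2 * m"
      using len \<open>k = 1\<close> m_ge by simp
    ultimately show False using f_short by fastforce
  qed
  moreover have "\<not> f (hd Q) z"
  proof
    assume *: "f (hd Q) z"
    obtain c where c: "c \<in> B2" using cards \<open>k = 1\<close> by fastforce
    have cc: "c \<notin> set P" "c \<noteq> hd Q" "c \<notin> A1 \<union> A2"
      subgoal using c disj(3) by blast
      subgoal using c Q_out(2) by blast
      subgoal using c subs A_B by blast
      done
    have "cyc f (P @ [y, c, z, hd Q, x0])"
      using P P_ne * f_hdQ y_last x0 f_commute xy Q_out x0 y z c cc f22
      by (intro cyc_append) (auto simp: path_Cons)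
    moreover have "length (P @ [y, c, z, hd Q, x0]) \<ge> 2 * m"
      using len \<open>k = 1\<close> m_ge by simp
    ultimately show False using f_short by fastforce
  qed
  \<comment> \<open>Uniqueness with the colours exchanged makes both blue neighbours
    \<open>y\<close> and \<open>z\<close> of \<open>hd Q\<close> equal to \<open>w\<close>.\<close>
  ultimately have "g (hd Q) y" "g (hd Q) z"
    using not_f y z ends by blast+
  moreover have "w \<in> {y, z}" using w A2 by blast
  moreover have "g (last Q) w" using w g_commute by blast
  ultimately show False
    using c.f_last_unique[of y w] c.f_last_unique[of z w] y z w by blast
qed

text \<open>Since \<open>hd P\<close> is blue to all of \<open>A2\<close>, a blue neighbour in
  \<open>A1\<close> forces \<open>A2\<close> to be a singleton by \<open>g_both\<close>. Then
  \<open>A1\<close> is one too, and its vertex is red to \<open>hd P\<close> by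
  \<open>attach\<close>.\<close>

lemma hd_P_A1:
  assumes x: "x \<in> A1"
  shows "f (hd P) x"
proof (rule ccontr)
  assume "\<not> f (hd P) x"
  then have gx: "g (hd P) x"
    using x subs(1) ends(1) g_iff f_commute g_commute by blast
  obtain a where a: "a \<in> A1" "g a (hd Q)" using attach by blast
  obtain w where w: "w \<in> A2" "g w (last Q)" using attach by blast
  have "hd P \<notin> set Q \<union> B1 \<union> B2"
    using ends_in disj by blast
  then have "x = a \<and> z = w" if "z \<in> A2" for z
    using g_both[OF ends(1) _ x gx that hd_P_A2[OF that] a w] by blast
  then have "A2 = {w}" using w by blast
  then have "card A1 = 1" using cards by simp
  then have "A1 = {x}" using x by (auto simp: card_1_singleton_iff)
  moreover obtain x0 where "x0 \<in> A1" "f x0 (hd P)" using attach by blast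
  ultimately have "f x (hd P)" by blast
  moreover have "g x (hd P)" using gx g_commute by blast
  moreover have "x \<in> A" using x subs(1) by blast
  ultimately show False using ends(1) g_iff by blast
qed

text \<open>The vertices \<open>hd P\<close> and \<open>last Q\<close> are red to \<open>A1\<close>
  and blue to \<open>A2\<close>, and \<open>last P\<close> and \<open>hd Q\<close> the other way
  round, by the symmetric versions of \<open>hd_P_A1\<close> and \<open>hd_P_A2\<close>. The blue
  path is reversed since \<open>last Q\<close> enters the set with index 1.\<close>

lemma next_cluster:
  assumes "Suc k < m"
  shows "cluster B A f g m (B1 \<union> {hd P, last Q}) (B2 \<union> {last P, hd Q}) A1 A2
    (tl (butlast P)) (rev (tl (butlast Q))) (Suc k)"
proof -
  interpret i: cluster A B f g m A2 A1 B2 B1 "rev P" "rev Q" k by (rule swap_indices)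
  interpret c: cluster A B g f m A1 A2 B2 B1 Q P k by (rule swap_cluster_colours)
  interpret ic: cluster A B g f m A2 A1 B1 B2 "rev Q" "rev P" k by (rule i.swap_cluster_colours)
  have len3: "3 \<le> length P" "3 \<le> length Q"
    using len assms by simp_all
  obtain ys where ys: "P = hd P # ys @ [last P]" "path f ys" "ys \<noteq> []"
    "f (hd P) (hd ys)" "f (last ys) (last P)" "hd P \<noteq> last P" "hd P \<notin> set ys" "last P \<notin> set ys"
    using path_tl_butlast[OF P len3(1)] .
  obtain zs where zs: "Q = hd Q # zs @ [last Q]" "path g zs" "zs \<noteq> []"
    "g (hd Q) (hd zs)" "g (last zs) (last Q)" "hd Q \<noteq> last Q" "hd Q \<notin> set zs" "last Q \<notin> set zs"
    using path_tl_butlast[OF Q len3(2)] .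
  have tb: "tl (butlast P) = ys" "tl (butlast Q) = zs"
    by (subst ys(1), simp add: butlast_append, subst zs(1), simp add: butlast_append)
  have sub: "set ys \<subseteq> set P" "set zs \<subseteq> set Q"
    by (subst ys(1), auto, subst zs(1), auto)
  have f1: "f b a" if "a \<in> A1" "b \<in> B1 \<union> {hd P, last Q}" for a b
    using that f11 hd_P_A1 ic.hd_P_A2[of a] f_commute Q_ne by (auto simp: hd_rev)
  have f2: "f b a" if "a \<in> A2" "b \<in> B2 \<union> {last P, hd Q}" for a b
    using that f22 c.hd_P_A2[of a] i.hd_P_A1[of a] f_commute P_ne by (auto simp: hd_rev)
  have g1: "g b a" if "a \<in> A2" "b \<in> B1 \<union> {hd P, last Q}" for a b
    using that g21 hd_P_A2 ic.hd_P_A1[of a] g_commute Q_ne by (auto simp: hd_rev)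
  have g2: "g b a" if "a \<in> A1" "b \<in> B2 \<union> {last P, hd Q}" for a b
    using that g12 c.hd_P_A1[of a] i.hd_P_A2[of a] g_commute P_ne by (auto simp: hd_rev)
  have mem: "hd P \<notin> B1" "last Q \<notin> B1" "last P \<notin> B2" "hd Q \<notin> B2"
    "hd P \<notin> B2" "last Q \<notin> B2" "last P \<notin> B1" "hd Q \<notin> B1"
    using ends_in disj(3,4) by blast+
  have PQ: "hd P \<noteq> last Q" "last P \<noteq> hd Q" "hd P \<noteq> hd Q" "last P \<noteq> last Q"
    using ends_in disj(5) by fastforce+
  have PQ': "hd P \<notin> set zs" "last P \<notin> set zs" "hd Q \<notin> set ys" "last Q \<notin> set ys"
    using ends_in disj(5) sub by blast+
  have ys_out: "set ys \<inter> (A1 \<union> A2 \<union> B1 \<union> B2) = {}" and zs_out: "set zs \<inter> (A1 \<union> A2 \<union> B1 \<union> B2) = {}"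
    using sub disj(3,4) by blast+
  show ?thesis
    unfolding tb
  proof (intro cluster.intro cluster_axioms.intro)
    show "bicoloured B A f g m" by (rule swap_sides)
    show "B1 \<union> {hd P, last Q} \<subseteq> B" "B2 \<union> {last P, hd Q} \<subseteq> B" "A1 \<subseteq> A" "A2 \<subseteq> A"
      using subs ends by auto
    show "(B1 \<union> {hd P, last Q}) \<inter> (B2 \<union> {last P, hd Q}) = {}" "A1 \<inter> A2 = {}"
      using disj(1,2) mem PQ ys(6) zs(6) by auto
    show "set ys \<inter> (B1 \<union> {hd P, last Q} \<union> (B2 \<union> {last P, hd Q}) \<union> A1 \<union> A2) = {}"
      using ys_out ys(7,8) PQ' by auto
    show "set (rev zs) \<inter> (B1 \<union> {hd P, last Q} \<union> (B2 \<union> {last P, hd Q}) \<union> A1 \<union> A2) = {}"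
      using zs_out zs(7,8) PQ' by auto
    show "set ys \<inter> set (rev zs) = {}" using sub disj(5) by auto
    show "path f ys" "path g (rev zs)" using ys(2) zs(2) path_rev[OF g_sym] by auto
    show "card (B1 \<union> {hd P, last Q}) = Suc (Suc k)" "card (B2 \<union> {last P, hd Q}) = Suc (Suc k)"
      using mem PQ cards fin by auto
    show "length ys = 2 * (m - Suc k) - 1" "length (rev zs) = 2 * (m - Suc k) - 1"
      using arg_cong[OF ys(1), of length] arg_cong[OF zs(1), of length] len by auto
    have "hd zs \<in> A" "last zs \<in> A" "hd ys \<in> A" "last ys \<in> A"
      using ends A_B f_cross[OF ys(4)] f_cross[OF ys(5)] g_cross[OF zs(4)] g_cross[OF zs(5)] by blast+
    then show "hd ys \<in> A" "last ys \<in> A" "hd (rev zs) \<in> A" "last (rev zs) \<in> A"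
      using zs(3) by (simp_all add: hd_rev last_rev)
    show "\<exists>a\<in>B1 \<union> {hd P, last Q}. f a (hd ys)" "\<exists>a\<in>B2 \<union> {last P, hd Q}. f a (last ys)"
      using ys(4,5) f_commute by blast+
    show "\<exists>a\<in>B1 \<union> {hd P, last Q}. g a (hd (rev zs))" "\<exists>a\<in>B2 \<union> {last P, hd Q}. g a (last (rev zs))"
      using zs(3-5) g_commute by (auto simp: hd_rev last_rev)
  qed (use assms cards f1 f2 g1 g2 in auto)
qed

text \<open>Here \<open>A1\<close> has \<open>m\<close> vertices but \<open>B1\<close> only
  \<open>m - 1\<close>; adding \<open>hd P\<close> completes a forbidden red complete bipartite
  graph.\<close>

lemma last_step:
  assumes "Suc k = m"
  shows False
proof (rule no_complete[of A1 "B1 \<union> {hd P}"])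
  have "hd P \<notin> B1" using ends_in disj by blast
  then show "m \<le> card (B1 \<union> {hd P})" using assms cards fin by simp
qed (use subs ends assms cards f11 hd_P_A1 f_commute in auto)

end

text \<open>Each growth step exchanges the sides, so the induction on \<open>m - k\<close>
  generalises over \<open>A\<close> and \<open>B\<close>.\<close>

lemma no_cluster: "\<not> cluster A B f g m A1 A2 B1 B2 P Q k"
proof (induction "m - k" arbitrary: A B A1 A2 B1 B2 P Q k rule: less_induct)
  case less
  show ?case
  proof
    assume c: "cluster A B f g m A1 A2 B1 B2 P Q k"
    then interpret cluster A B f g m A1 A2 B1 B2 P Q k .
    show False
    proof (cases "Suc k = m")
      case True
      then show False by (rule last_step)
    next
      case False
      then have "Suc k < m" using k_less by simp
      then show False
        using next_cluster less[of "Suc k"] by fastforce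
    qed
  qed
qed

subsection \<open>Unions of a red and a blue path\<close>

lemma alternating:
  assumes "\<And>u v. R u v \<Longrightarrow> u \<in> A \<and> v \<in> B \<or> u \<in> B \<and> v \<in> A" "A \<inter> B = {}"
    and "path R xs" "xs \<noteq> []" "hd xs \<in> A"
  shows "set xs \<subseteq> A \<union> B" "last xs \<in> A \<longleftrightarrow> odd (length xs)" "last xs \<in> B \<longleftrightarrow> even (length xs)"
    "card (set xs \<inter> A) = (length xs + 1) div 2" "card (set xs \<inter> B) = length xs div 2"
proof -
  have "set xs \<subseteq> A \<union> B \<and> (last xs \<in> A \<longleftrightarrow> odd (length xs)) \<and> (last xs \<in> B \<longleftrightarrow> even (length xs)) \<and>
    card (set xs \<inter> A) = (length xs + 1) div 2 \<and> card (set xs \<inter> B) = length xs div 2"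
    using assms
  proof (induction xs arbitrary: A B)
    case Nil
    then show ?case by simp
  next
    case (Cons x xs)
    have x: "x \<in> A" "x \<notin> B" using Cons.prems by auto
    show ?case
    proof (cases "xs = []")
      case True
      then show ?thesis using x by simp
    next
      case False
      have R: "R x (hd xs)" "path R xs" "x \<notin> set xs"
        using Cons.prems(3) False by (auto simp: path_Cons)
      have hd: "hd xs \<in> B"
        using Cons.prems(1)[OF R(1)] x by blast
      have "set xs \<subseteq> B \<union> A \<and> (last xs \<in> B \<longleftrightarrow> odd (length xs)) \<and> (last xs \<in> A \<longleftrightarrow> even (length xs)) \<and>
        card (set xs \<inter> B) = (length xs + 1) div 2 \<and> card (set xs \<inter> A) = length xs div 2"
      proof (rule Cons.IH)
        show "\<And>u v. R u v \<Longrightarrow> u \<in> B \<and> v \<in> A \<or> u \<in> A \<and> v \<in> B"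
          using Cons.prems(1) by blast
      qed (use Cons.prems(2) R hd False in auto)
      then show ?thesis
        using x R(3) False by (auto simp: Int_insert_left)
    qed
  qed
  then show "set xs \<subseteq> A \<union> B" "last xs \<in> A \<longleftrightarrow> odd (length xs)" "last xs \<in> B \<longleftrightarrow> even (length xs)"
    "card (set xs \<inter> A) = (length xs + 1) div 2" "card (set xs \<inter> B) = length xs div 2"
    by blast+
qed

text \<open>
  The vertices \<open>x\<close> and \<open>y\<close> belong to both paths, so such a cycle has \<open>length p + length q + 2\<close> vertices;
  \<open>p\<close> or \<open>q\<close> may be empty.
\<close>

definition bi :: "('v \<Rightarrow> 'v \<Rightarrow> bool) \<Rightarrow> ('v \<Rightarrow> 'v \<Rightarrow> bool) \<Rightarrow> 'v \<Rightarrow> 'v list \<Rightarrow> 'v \<Rightarrow> 'v list \<Rightarrow> bool" where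
  "bi f g x p y q \<longleftrightarrow> path f (x # p @ [y]) \<and> path g (x # q @ [y]) \<and> set p \<inter> set q = {}"

abbreviation verts :: "'v \<Rightarrow> 'v list \<Rightarrow> 'v \<Rightarrow> 'v list \<Rightarrow> 'v set" where
  "verts x p y q \<equiv> {x, y} \<union> set p \<union> set q"

lemma bi_colours: "bi f g x p y q \<Longrightarrow> bi g f x q y p"
  by (auto simp: bi_def)

lemma bi_rev:
  assumes "symp f" "symp g" "bi f g x p y q"
  shows "bi f g y (rev p) x (rev q)"
  using assms path_rev[of f "x # p @ [y]"] path_rev[of g "x # q @ [y]"] by (simp add: bi_def)

section \<open>Balance and parity of two-coloured cycles\<close>

context bicoloured
begin

text \<open>Forgetting the colours, the two paths form one cycle \<open>zs\<close> whose edges cross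
  between the sides; it is even because its last vertex is adjacent to \<open>x\<close>.\<close>

lemma bi_balanced_A:
  assumes bi: "bi f g x p y q" and x: "x \<in> A"
  shows "verts x p y q \<subseteq> A \<union> B" "even (length p + length q)"
    "2 * card (verts x p y q \<inter> A) = length p + length q + 2"
    "2 * card (verts x p y q \<inter> B) = length p + length q + 2"
proof -
  define R where "R = (\<lambda>u v. f u v \<or> g u v)"
  define zs where "zs = x # p @ [y] @ rev q"
  have mono: "path R us" if "path f us \<or> path g us" for us
    using that successively_mono[of _ us R] unfolding path_def R_def by blast
  have R: "R u v \<Longrightarrow> u \<in> A \<and> v \<in> B \<or> u \<in> B \<and> v \<in> A" for u v
    using f_cross g_cross unfolding R_def by blast
  have "path g (rev (x # q @ [y]))"
    using bi path_rev[OF g_sym, of "x # q @ [y]"] by (simp add: bi_def)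
  then have "path R (y # rev q @ [x])" by (intro mono) simp
  moreover have "path R (x # p @ [y])"
    using bi mono by (simp add: bi_def)
  ultimately have *: "path R zs" "R (last zs) x"
    using bi unfolding zs_def bi_def by (auto simp: path_Cons path_append last_rev hd_append)
  have zs: "zs \<noteq> []" "hd zs = x" "set zs = verts x p y q" "length zs = length p + length q + 2"
    by (auto simp: zs_def)
  note alt = alternating[OF R A_B *(1) zs(1)]
  have "last zs \<in> B" using R[OF *(2)] x A_B by blast
  then have ev: "even (length zs)" using alt x zs by simp
  then show "verts x p y q \<subseteq> A \<union> B" "even (length p + length q)"
    "2 * card (verts x p y q \<inter> A) = length p + length q + 2"
    "2 * card (verts x p y q \<inter> B) = length p + length q + 2"
    using alt(1,4,5) x unfolding zs by (auto elim!: evenE)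
qed

lemma bi_balanced:
  assumes bi: "bi f g x p y q"
  shows "verts x p y q \<subseteq> A \<union> B" "even (length p + length q)"
    "2 * card (verts x p y q \<inter> A) = length p + length q + 2"
    "2 * card (verts x p y q \<inter> B) = length p + length q + 2"
proof -
  interpret s: bicoloured B A f g m by (rule swap_sides)
  have "f x (hd (p @ [y]))" using bi by (simp add: bi_def path_Cons)
  then consider "x \<in> A" | "x \<in> B" using f_cross by blast
  then show "verts x p y q \<subseteq> A \<union> B" "even (length p + length q)"
    "2 * card (verts x p y q \<inter> A) = length p + length q + 2"
    "2 * card (verts x p y q \<inter> B) = length p + length q + 2"
    using bi_balanced_A[OF bi] s.bi_balanced_A[OF bi] by (cases; auto)+
qed

lemma bi_parity:
  assumes bi: "bi f g x p y q" and x: "x \<in> A"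
  shows "y \<in> A \<longleftrightarrow> odd (length p)" "y \<in> B \<longleftrightarrow> even (length p)"
    "y \<in> A \<longleftrightarrow> odd (length q)" "y \<in> B \<longleftrightarrow> even (length q)"
  using alternating(2,3)[of f A B "x # p @ [y]"] alternating(2,3)[of g A B "x # q @ [y]"]
    bi x f_cross g_cross A_B by (auto simp: bi_def)

end

text \<open>In the application \<open>M\<close> is the greatest length among unions of two paths and
  monochromatic cycles; the strict bounds come from \<open>cyc_not_max\<close>. That a given union
  attains \<open>M\<close> is a separate hypothesis of the lemmas.\<close>

locale maximal = bicoloured +
  fixes M :: nat
  assumes bi_max: "bi f g x p y q \<Longrightarrow> length p + length q + 2 \<le> M"
    and f_lt: "cyc f xs \<Longrightarrow> length xs < M"
    and g_lt: "cyc g xs \<Longrightarrow> length xs < M"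
begin

lemma maximal_colours: "maximal A B g f m M"
proof (intro maximal.intro maximal_axioms.intro swap_colours)
  fix x p y q assume "bi g f x p y q"
  then show "length p + length q + 2 \<le> M"
    using bi_max[OF bi_colours] by (simp add: add.commute)
qed (use f_lt g_lt in auto)

lemma maximal_sides: "maximal B A f g m M"
  using swap_sides bi_max f_lt g_lt by (auto simp: maximal_def maximal_axioms_def)

text \<open>With any other colours of the edge \<open>w u\<close> and of the edge from
  \<open>u\<close> to the successor of \<open>x\<close>, both \<open>u\<close> and \<open>w\<close>
  could be inserted into the cycle.\<close>

lemma insert_pair:
  assumes bi: "bi f g x p y q" and M: "length p + length q + 2 = M"
    and x: "x \<in> A" and u: "u \<in> A" "u \<notin> verts x p y q" and w: "w \<in> B" "w \<notin> verts x p y q"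
    and g: "g x w"
  shows "f w u" "g u (hd (p @ [y]))"
proof -
  let ?r = "hd (p @ [y])"
  have r: "f x ?r" using bi by (simp add: bi_def path_Cons)
  have rB: "?r \<in> B" using f_cross[OF r] x A_B by blast
  have ne: "u \<noteq> w" using u w A_B by blast
  have 1: "\<not> f u ?r"
  proof
    assume fr: "f u ?r"
    have "\<not> f w u"
    proof
      assume "f w u"
      then have "bi f g w (u # p) y (x # q)"
        using bi fr u w g ne g_commute by (auto simp: bi_def path_Cons)
      then show False using bi_max M by fastforce
    qed
    then have "g u w" using g_iff u w f_commute by blast
    then have "bi f g u p y (w # x # q)"
      using bi fr u w g ne g_commute by (auto simp: bi_def path_Cons)
    then show False using bi_max M by fastforce
  qed
  then show gr: "g u ?r" using g_iff u rB by blast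
  show "f w u"
  proof (rule ccontr)
    assume "\<not> f w u"
    then have guw: "g u w" using g_iff u w f_commute by blast
    show False
    proof (cases p)
      \<comment> \<open>With \<open>p\<close> empty the successor of \<open>x\<close> is
        \<open>y\<close>, and the insertion yields a blue cycle rather than a union; hence the bound
        \<open>g_lt\<close>.\<close>
      case Nil
      have "cyc g ((u # w # x # q) @ [y])"
        using bi u w g ne g_commute guw gr Nil
        by (intro cyc_append) (auto simp: bi_def path_Cons path_append hd_append split: if_splits)
      then show False using g_lt M Nil by fastforce
    next
      case (Cons r p')
      have "bi f g r p' y (u # w # x # q)"
        using bi u w g ne g_commute guw gr Cons by (auto simp: bi_def path_Cons)
      then show False using bi_max M Cons by fastforce
    qed
  qed
qed

text \<open>If \<open>x w\<close> were red, \<open>insert_pair\<close> with the colours exchanged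
  would make \<open>w u\<close> blue.\<close>

lemma insert_type:
  assumes bi: "bi f g x p y q" and M: "length p + length q + 2 = M"
    and x: "x \<in> A" and u: "u \<in> A" "u \<notin> verts x p y q" and w: "w \<in> B" "w \<notin> verts x p y q"
    and f: "f w u"
  shows "g x w" "g u (hd (p @ [y]))"
proof -
  interpret c: maximal A B g f m M by (rule maximal_colours)
  have "\<not> f x w"
  proof
    assume *: "f x w"
    have "g w u"
      by (rule c.insert_pair[OF bi_colours[OF bi] _ x u(1) _ w(1) _ *]) (use u w M in auto)
    then show False using f f_g_excl by blast
  qed
  then show "g x w" using g_iff x w by blast
  then show "g u (hd (p @ [y]))"
    using insert_pair[OF bi M x u w] by blast
qed

text \<open>Applied at both ends, \<open>insert_type\<close> gives a blue path \<open>u\<close>,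
  \<open>y\<close>, reversed \<open>q\<close>, \<open>x\<close>, \<open>w\<close> and blue edges
  from \<open>u\<close> and \<open>w\<close> to the ends of \<open>p\<close>. This yields a union
  with two more vertices; if \<open>p\<close> is empty, the edge \<open>w u\<close> serves as the
  red path.\<close>

lemma even_spans_aux:
  assumes bi: "bi f g x p y q" and M: "length p + length q + 2 = M"
    and x: "x \<in> A" and y: "y \<in> B"
    and u: "u \<in> A" "u \<notin> verts x p y q" and w: "w \<in> B" "w \<notin> verts x p y q"
    and f: "f w u"
  shows False
proof -
  interpret s: maximal B A f g m M by (rule maximal_sides)
  have gx: "g x w" "g u (hd (p @ [y]))"
    using insert_type[OF bi M x u w f] by blast+
  have rbi: "bi f g y (rev p) x (rev q)" using bi_rev[OF f_sym g_sym bi] .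
  have gy: "g y u" "g w (hd (rev p @ [x]))"
    using s.insert_type[OF rbi _ y w(1) _ u(1)] u w M f f_commute by auto
  have ne: "u \<noteq> w" using u w A_B by blast
  have pev: "even (length p)" using bi_parity(2)[OF bi x] y by simp
  show False
  proof (cases "p = []")
    case True
    then have "bi f g w [] u (x # q @ [y])"
      using bi u w f ne gx(1) gy(1) g_commute
      by (auto simp: bi_def path_Cons path_append hd_append split: if_splits)
    then show False using bi_max M True by fastforce
  next
    case False
    then obtain r p0 r' where p: "p = r # p0 @ [r']"
      using pev by (cases p; cases "tl p" rule: rev_cases) auto
    have "path g (rev (x # q @ [y]))"
      using bi path_rev[OF g_sym, of "x # q @ [y]"] by (simp add: bi_def)
    then have "path g (y # rev q @ [x])" by simp
    then have "path g (u # (y # rev q @ [x]) @ [w])"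
      using u w ne gx(1) gy(1) g_commute
      by (intro path_extend[of g "y # rev q @ [x]"]) auto
    moreover define qs where "qs = u # (y # rev q @ [x]) @ [w]"
    ultimately have "path g qs" "hd qs = u" "last qs = w" "qs \<noteq> []"
      by simp_all
    moreover have "set qs \<inter> set p = {}"
      using bi u w unfolding qs_def by (auto simp: bi_def path_Cons path_append)
    moreover have "path f p" using bi by (simp add: bi_def path_Cons path_append)
    moreover from this have "r \<noteq> r'" using p by (auto simp: path_Cons)
    ultimately have "path g (r # qs @ [r'])" "set p0 \<inter> set qs = {}" "path f (r # p0 @ [r'])"
      using gx(2) gy(2) g_commute p by (auto intro!: path_extend[of g qs])
    then have "bi f g r p0 r' qs" by (simp add: bi_def)
    moreover have "length qs = length q + 4" by (simp add: qs_def)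
    ultimately have "length p0 + length q + 6 \<le> M" using bi_max by fastforce
    then show False using M p by simp
  qed
qed

lemma even_spans:
  assumes bi: "bi f g x p y q" and M: "length p + length q + 2 = M"
    and x: "x \<in> A" and y: "y \<in> B"
    and u: "u \<in> A" "u \<notin> verts x p y q" and w: "w \<in> B" "w \<notin> verts x p y q"
  shows False
proof -
  interpret c: maximal A B g f m M by (rule maximal_colours)
  consider "f w u" | "g w u" using g_iff[OF u(1) w(1)] f_commute g_commute by blast
  then show False
  proof cases
    case 1
    then show False by (rule even_spans_aux[OF assms])
  next
    case 2
    show False
      by (rule c.even_spans_aux[OF bi_colours[OF bi] _ x y u(1) _ w(1) _ 2]) (use M u w in auto)
  qed
qed

text \<open>If \<open>w a\<close> were red, \<open>w\<close> could replace \<open>r\<close> in a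
  union of the same length with ends on different sides, which \<open>even_spans\<close> excludes.
  So \<open>w a\<close> is blue, and the red path gets two vertices shorter and the blue one two
  longer, with \<open>w\<close> in place of \<open>r\<close>.\<close>

lemma odd_step:
  assumes bi: "bi f g x (r # a # p) y q" and M: "length (r # a # p) + length q + 2 = M"
    and x: "x \<in> A" and y: "y \<in> A"
    and u: "u \<in> A" "u \<notin> verts x (r # a # p) y q" and w: "w \<in> B" "w \<notin> verts x (r # a # p) y q"
    and g: "g x w"
  shows "bi f g a p y (w # x # q)" "a \<in> A" "r \<in> B"
proof -
  have "f x r" "f r a" using bi by (auto simp: bi_def path_Cons)
  then show r: "r \<in> B" and a: "a \<in> A" using f_cross x A_B by blast+
  have "\<not> f w a"
  proof
    assume "f w a"
    then have "bi f g w (a # p) y (x # q)"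
      using bi w g g_commute by (auto simp: bi_def path_Cons)
    then have *: "bi f g y (rev (a # p)) w (rev (x # q))"
      using bi_rev[OF f_sym g_sym] by blast
    have "u \<noteq> w" using u w A_B by blast
    moreover have "r \<notin> verts y (a # p) w (x # q)"
      using bi w by (auto simp: bi_def path_Cons path_append)
    ultimately show False
      by (intro even_spans[OF * _ y w(1) u(1) _ r]) (use M u in auto)
  qed
  then have "g a w" using g_iff a w f_commute by blast
  then show "bi f g a p y (w # x # q)"
    using bi w g g_commute by (auto simp: bi_def path_Cons)
qed

text \<open>Both \<open>x\<close> and \<open>y\<close> are joined to \<open>w\<close> in blue, so
  \<open>w\<close> closes the blue path to a cycle.\<close>

lemma odd_close:
  assumes bi: "bi f g x p y q" and M: "length p + length q + 2 = M"
    and x: "x \<in> A" and y: "y \<in> A"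
    and u: "u \<in> A" "u \<notin> verts x p y q" and w: "w \<in> B" "w \<notin> verts x p y q"
    and f: "f w u"
  shows "length q + 3 < 2 * m"
proof -
  have "g x w" using insert_type(1)[OF bi M x u w f] .
  moreover have "g y w"
    using insert_type(1)[OF bi_rev[OF f_sym g_sym bi] _ y u(1) _ w(1) _ f] M u w by auto
  ultimately have "cyc g ((x # q @ [y]) @ [w])"
    using bi w g_commute by (intro cyc_append) (auto simp: bi_def path_Cons)
  then show ?thesis using g_short by fastforce
qed

text \<open>Each \<open>odd_step\<close> uses up one red neighbour \<open>w\<close> of
  \<open>u\<close> and lengthens \<open>q\<close> by two, so the sum bounded below by
  \<open>m\<close> does not drop. As \<open>odd_close\<close> bounds \<open>q\<close>, another step
  is always possible, while \<open>p\<close> keeps shrinking.\<close>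

lemma odd_false:
  assumes "bi f g x p y q" "length p + length q + 2 = M" "x \<in> A" "y \<in> A"
    and "u \<in> A" "u \<notin> verts x p y q"
    and "1 \<le> card {w \<in> B - verts x p y q. f w u}"
    and "m \<le> (length q + 1) div 2 + card {w \<in> B - verts x p y q. f w u}"
    and "2 * m \<le> M"
  shows False
  using assms
proof (induction "length p" arbitrary: x p q rule: less_induct)
  case less
  let ?K = "{w \<in> B - verts x p y q. f w u}"
  have "?K \<noteq> {}" using less.prems(7) by (metis card.empty not_one_le_zero)
  then obtain w where w: "w \<in> B" "w \<notin> verts x p y q" "f w u" by blast
  note close = odd_close[OF less.prems(1-6) w]
  have gxw: "g x w" using insert_type(1)[OF less.prems(1-3,5,6) w] .
  have "2 \<le> length p" using close less.prems(2,9) by linarith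
  then obtain r a p' where p: "p = r # a # p'"
    by (cases p; cases "tl p") auto
  note step = odd_step[OF less.prems(1-6)[unfolded p] w(1,2)[unfolded p] gxw]
  let ?K' = "{z \<in> B - verts a p' y (w # x # q). f z u}"
  have "?K - {w} \<subseteq> ?K'" using p by auto
  then have "card (?K - {w}) \<le> card ?K'" by (intro card_mono) auto
  moreover have "card (?K - {w}) = card ?K - 1" using w by simp
  ultimately have K': "card ?K \<le> card ?K' + 1" by linarith
  have K2: "2 \<le> card ?K" using close less.prems(8) by linarith
  show False
  proof (rule less.hyps[OF _ step(1) _ step(2) less.prems(4,5)])
    show "u \<notin> verts a p' y (w # x # q)"
      using less.prems(5,6) w(1) A_B p by auto
    show "1 \<le> card ?K'" using K' K2 by linarith
    show "m \<le> (length (w # x # q) + 1) div 2 + card ?K'"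
      using K' less.prems(8) by simp
  qed (use p less.prems(2,9) in auto)
qed

text \<open>If \<open>u\<close> has no red neighbour outside, then \<open>q\<close> has at least
  \<open>2 * m - 1\<close> vertices. A step with the colours exchanged frees \<open>s\<close>, which
  is forced to be red to \<open>u\<close>; now \<open>odd_close\<close> applies, but
  \<open>q'\<close> is still too long for it.\<close>

lemma odd_spans_aux:
  assumes bi: "bi f g x p y q" and M: "length p + length q + 2 = M" and x: "x \<in> A" and y: "y \<in> A"
    and u: "u \<in> A" "u \<notin> verts x p y q" and w: "w \<in> B" "w \<notin> verts x p y q"
    and m: "m \<le> (length q + 1) div 2 + card {w \<in> B - verts x p y q. f w u}"
    and M': "2 * m \<le> M"
  shows False
proof (cases "1 \<le> card {w \<in> B - verts x p y q. f w u}")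
  case True
  then show False using odd_false[OF bi M x y u _ m M'] by blast
next
  case False
  interpret c: maximal A B g f m M by (rule maximal_colours)
  have "{w \<in> B - verts x p y q. f w u} = {}"
    using False by (simp add: card_eq_0_iff Suc_le_eq)
  then have "g w u" using u w g_iff f_commute g_commute by blast
  have bi': "bi g f x q y p" using bi_colours[OF bi] .
  have out: "u \<notin> verts x q y p" "w \<notin> verts x q y p" and M2: "length q + length p + 2 = M"
    using u w M by auto
  have "f x w" using c.insert_type(1)[OF bi' M2 x u(1) out(1) w(1) out(2) \<open>g w u\<close>] .
  have q_len: "2 * m \<le> length q + 1" using m False by linarith
  then have "2 \<le> length q" using m_ge by linarith
  then obtain s a q' where q: "q = s # a # q'"
    by (cases q; cases "tl q") auto
  note step = c.odd_step[OF bi'[unfolded q] M2[unfolded q] x y u(1) out(1)[unfolded q] w(1)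
      out(2)[unfolded q] \<open>f x w\<close>]
  have new: "bi f g a (w # x # p) y q'" using bi_colours[OF step(1)] .
  have newM: "length (w # x # p) + length q' + 2 = M" using M q by simp
  have u': "u \<notin> verts a (w # x # p) y q'" using u w(1) A_B q by auto
  have s': "s \<notin> verts a (w # x # p) y q'"
    using bi w unfolding q by (auto simp: bi_def path_Cons path_append)
  have "g a s" using bi g_commute unfolding q by (auto simp: bi_def path_Cons)
  then have "f s u"
    using insert_pair(1)[OF new newM step(2) u(1) u' step(3) s'] by blast
  then show False
    using odd_close[OF new newM step(2) y u(1) u' step(3) s'] q_len q by simp
qed

lemma card_outside:
  assumes "bi f g x p y q" "length p + length q + 2 = M"
  shows "2 * card (A - verts x p y q) + M = 4 * m" "2 * card (B - verts x p y q) + M = 4 * m"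
proof -
  have "card (A - verts x p y q) = card A - card (verts x p y q \<inter> A)"
    "card (B - verts x p y q) = card B - card (verts x p y q \<inter> B)"
    by (simp_all add: card_Diff_subset_Int Int_commute)
  moreover have "card (verts x p y q \<inter> A) \<le> card A" "card (verts x p y q \<inter> B) \<le> card B"
    by (simp_all add: card_mono)
  ultimately show "2 * card (A - verts x p y q) + M = 4 * m" "2 * card (B - verts x p y q) + M = 4 * m"
    using bi_balanced(3,4)[OF assms(1)] assms(2) card_A card_B by linarith+
qed

text \<open>Otherwise more than \<open>m\<close> vertices of each side are outside. A vertex of
  \<open>W\<close> has the same colour to all of \<open>U\<close> as to \<open>u\<close>, so either
  one colour is complete between \<open>U\<close> and \<open>W\<close>, or red and blue paths from
  \<open>u1\<close> to \<open>u2\<close> cover all outside vertices.\<close>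

lemma M_large:
  assumes bi: "bi f g x p y q" and M: "length p + length q + 2 = M" and x: "x \<in> A"
    and u: "u \<in> A" "u \<notin> verts x p y q"
  shows "2 * m \<le> M"
proof (rule ccontr)
  assume "\<not> 2 * m \<le> M"
  interpret c: maximal A B g f m M by (rule maximal_colours)
  define U where "U = A - verts x p y q"
  define W where "W = B - verts x p y q"
  define K where "K = {w \<in> W. f w u}"
  define L where "L = {w \<in> W. g w u}"
  have c: "2 * card U + M = 4 * m" "2 * card W + M = 4 * m"
    using card_outside[OF bi M] by (simp_all add: U_def W_def)
  have big: "m < card U" "card W = card U"
    using c \<open>\<not> 2 * m \<le> M\<close> by linarith+
  have fin: "finite U" "finite W" "finite K" "finite L"
    unfolding U_def W_def K_def L_def by auto
  have K: "f z w" if "z \<in> U" "w \<in> K" for z w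
  proof -
    have w: "w \<in> B" "w \<notin> verts x p y q" "f w u" using that by (auto simp: K_def W_def)
    have z: "z \<in> A" "z \<notin> verts x p y q" using that by (auto simp: U_def)
    show ?thesis
      using insert_pair(1)[OF bi M x z w(1,2) insert_type(1)[OF bi M x u w]] f_commute by blast
  qed
  have L: "g z w" if "z \<in> U" "w \<in> L" for z w
  proof -
    have w: "w \<in> B" "w \<notin> verts x q y p" "g w u" using that by (auto simp: L_def W_def)
    have z: "z \<in> A" "z \<notin> verts x q y p" using that by (auto simp: U_def)
    have u': "u \<notin> verts x q y p" and M': "length q + length p + 2 = M" using u M by auto
    note bi' = bi_colours[OF bi]
    show ?thesis
      using c.insert_pair(1)[OF bi' M' x z w(1,2) c.insert_type(1)[OF bi' M' x u(1) u' w]] g_commute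
      by blast
  qed
  have W: "W = K \<union> L"
    using u g_iff f_commute g_commute unfolding K_def L_def W_def by blast
  have disj: "K \<inter> L = {}"
    using f_g_excl unfolding K_def L_def by blast
  then have card_KL: "card K + card L = card U"
    using W big fin by (metis card_Un_disjoint)
  have sub: "U \<subseteq> A" "W \<subseteq> B" "K \<subseteq> W" "L \<subseteq> W" by (auto simp: U_def W_def K_def L_def)
  show False
  proof (cases "K = {} \<or> L = {}")
    case True
    then consider "W = L" | "W = K" using W by blast
    then show False
    proof cases
      case 1
      then show False using c.no_complete[of U L] sub L big by auto
    next
      case 2
      then show False using no_complete[of U K] sub K big by auto
    qed
  next
    case False
    then have pos: "1 \<le> card K" "1 \<le> card L"
      using fin by (simp_all add: Suc_le_eq card_gt_0_iff)
    have "\<not> card U \<le> Suc 0" using big m_ge by linarith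
    then obtain u1 u2 where u12: "u1 \<in> U" "u2 \<in> U" "u1 \<noteq> u2"
      using card_le_Suc0_iff_eq[OF fin(1)] by blast
    have cU: "card (U - {u1, u2}) = card U - 2"
      using u12 fin by (simp add: card_Diff_subset)
    \<comment> \<open>The rest of \<open>U\<close> is split so that the red path can use all of
      \<open>K\<close> and the blue path all of \<open>L\<close>.\<close>
    obtain U1 where U1: "U1 \<subseteq> U - {u1, u2}" "card U1 = card K - 1"
    proof -
      have "card K - 1 \<le> card (U - {u1, u2})" using cU card_KL pos by linarith
      then show ?thesis using that by (meson obtain_subset_with_card_n)
    qed
    define U2 where "U2 = U - {u1, u2} - U1"
    have cU2: "card U2 = card L - 1"
    proof -
      have "card U2 = card (U - {u1, u2}) - card U1"
        unfolding U2_def using U1(1) fin by (meson card_Diff_subset finite_Diff finite_subset)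
      then show ?thesis using cU U1(2) card_KL pos by linarith
    qed
    have fin12: "finite U1" "finite U2"
      using U1(1) fin finite_subset by (auto simp: U2_def)
    have UW: "U \<inter> W = {}" using A_B sub by blast
    have "card ({u1, u2} \<union> U1) = card U1 + 2" "card ({u1, u2} \<union> U2) = card U2 + 2"
      using U1(1) u12 fin12 by (auto simp: U2_def card_insert_if)
    then have cS: "card ({u1, u2} \<union> U1) = card K + 1" "card ({u1, u2} \<union> U2) = card L + 1"
      using U1(2) cU2 pos by linarith+
    have S: "{u1, u2} \<union> U1 \<subseteq> U" "{u1, u2} \<union> U2 \<subseteq> U"
      using U1(1) u12 by (auto simp: U2_def)
    have "\<exists>xs. path f (u1 # xs @ [u2]) \<and> set xs \<subseteq> ({u1, u2} \<union> U1) \<union> K \<and> length xs = 2 * card K - 1"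
    proof (rule complete_path)
      show "({u1, u2} \<union> U1) \<inter> K = {}" using S(1) sub(3) UW by blast
      show "f s t" if "s \<in> {u1, u2} \<union> U1" "t \<in> K" for s t
        using K subsetD[OF S(1) that(1)] that(2) by blast
    qed (use fin fin12 f_sym u12 pos cS in auto)
    then obtain xs where xs: "path f (u1 # xs @ [u2])" "set xs \<subseteq> ({u1, u2} \<union> U1) \<union> K"
      "length xs = 2 * card K - 1" by blast
    have "\<exists>ys. path g (u1 # ys @ [u2]) \<and> set ys \<subseteq> ({u1, u2} \<union> U2) \<union> L \<and> length ys = 2 * card L - 1"
    proof (rule complete_path)
      show "({u1, u2} \<union> U2) \<inter> L = {}" using S(2) sub(4) UW by blast
      show "g s t" if "s \<in> {u1, u2} \<union> U2" "t \<in> L" for s t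
        using L subsetD[OF S(2) that(1)] that(2) by blast
    qed (use fin fin12 g_sym u12 pos cS in auto)
    then obtain ys where ys: "path g (u1 # ys @ [u2])" "set ys \<subseteq> ({u1, u2} \<union> U2) \<union> L"
      "length ys = 2 * card L - 1" by blast
    have "set xs \<subseteq> U1 \<union> K" "set ys \<subseteq> U2 \<union> L"
      using xs(1,2) ys(1,2) by (auto simp: path_Cons path_append)
    moreover have "(U1 \<union> K) \<inter> (U2 \<union> L) = {}"
    proof -
      have "U1 \<inter> U2 = {}" by (auto simp: U2_def)
      moreover have "U1 \<inter> L = {}" using S(1) sub(4) UW by blast
      moreover have "K \<inter> U2 = {}" using S(2) sub(3) UW by blast
      ultimately show ?thesis using disj by blast
    qed
    ultimately have "bi f g u1 xs u2 ys"
      using xs(1) ys(1) unfolding bi_def by blast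
    \<comment> \<open>The new union has \<open>2 * card U = 4 * m - M\<close> vertices, more than
      \<open>M\<close>.\<close>
    then show False
      using bi_max[of u1 xs u2 ys] xs(3) ys(3) pos card_KL big c by linarith
  qed
qed

text \<open>The sums that \<open>odd_spans_aux\<close> needs for the two colours add up to
  \<open>2 * m\<close>, so one of them is at least \<open>m\<close>.\<close>

lemma odd_spans:
  assumes bi: "bi f g x p y q" and M: "length p + length q + 2 = M" and x: "x \<in> A" and y: "y \<in> A"
    and u: "u \<in> A" "u \<notin> verts x p y q" and w: "w \<in> B" "w \<notin> verts x p y q"
  shows False
proof -
  interpret c: maximal A B g f m M by (rule maximal_colours)
  let ?K = "{w \<in> B - verts x p y q. f w u}" and ?L = "{w \<in> B - verts x p y q. g w u}"
  have "B - verts x p y q = ?K \<union> ?L"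
    using u g_iff f_commute g_commute by blast
  moreover have "?K \<inter> ?L = {}" using f_g_excl by blast
  ultimately have "card (B - verts x p y q) = card ?K + card ?L"
    by (metis (no_types, lifting) card_Un_disjoint finite_B finite_Diff finite_Un)
  then have KL: "2 * (card ?K + card ?L) + M = 4 * m"
    using card_outside(2)[OF bi M] by simp
  have "odd (length p)" "odd (length q)"
    using bi_parity(1,3)[OF bi x] y by blast+
  then obtain a b where ab: "length p = 2 * a + 1" "length q = 2 * b + 1"
    by (auto elim!: oddE)
  have "a + 1 + card ?L + (b + 1 + card ?K) = 2 * m"
    using KL M unfolding ab by simp
  moreover have "(length p + 1) div 2 = a + 1" "(length q + 1) div 2 = b + 1"
    unfolding ab by simp_all
  ultimately consider "m \<le> (length q + 1) div 2 + card ?K" | "m \<le> (length p + 1) div 2 + card ?L"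
    by fastforce
  then show False
  proof cases
    case 1
    then show False
      using odd_spans_aux[OF assms _ M_large[OF bi M x u]] by blast
  next
    case 2
    have V: "verts x q y p = verts x p y q" by auto
    show False
      by (rule c.odd_spans_aux[OF bi_colours[OF bi] _ x y u(1) _ w(1) _ _ M_large[OF bi M x u]])
        (use M u w 2 in \<open>simp_all only: V\<close>, simp_all)
  qed
qed

text \<open>Being balanced, a union that is not Hamiltonian misses a vertex on each side.\<close>

lemma spans:
  assumes bi: "bi f g x p y q" and M: "length p + length q + 2 = M"
  shows "M = 4 * m"
proof (rule ccontr)
  assume ne: "M \<noteq> 4 * m"
  interpret s: maximal B A f g m M by (rule maximal_sides)
  have "card (A - verts x p y q) \<noteq> 0" "card (B - verts x p y q) \<noteq> 0"
    using card_outside[OF bi M] ne by linarith+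
  then obtain u w where u: "u \<in> A" "u \<notin> verts x p y q" and w: "w \<in> B" "w \<notin> verts x p y q"
    by (metis DiffE card.empty ex_in_conv)
  have "x \<in> A \<union> B" "y \<in> A \<union> B" using bi_balanced(1)[OF bi] by auto
  moreover have rbi: "bi f g y (rev p) x (rev q)" using bi_rev[OF f_sym g_sym bi] .
  ultimately consider "x \<in> A" "y \<in> A" | "x \<in> A" "y \<in> B" | "x \<in> B" "y \<in> A" | "x \<in> B" "y \<in> B" by blast
  then show False
  proof cases
    case 1
    then show False using odd_spans[OF bi M _ _ u w] by blast
  next
    case 2
    then show False using even_spans[OF bi M _ _ u w] by blast
  next
    case 3
    show False
      by (rule even_spans[OF rbi _ 3(2,1) u(1) _ w(1)]) (use M u w in auto)
  next
    case 4
    then show False using s.odd_spans[OF bi M _ _ w u] by blast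
  qed
qed

end

subsection \<open>Hamiltonian unions of two paths\<close>

context bicoloured
begin

lemma no_spanning_even_aux:
  assumes bi: "bi f g x p y q" and x: "x \<in> A" and y: "y \<in> B"
    and len: "length p + length q + 2 = 4 * m" and le: "length q \<le> length p"
  shows False
proof -
  define P where "P = x # p @ [y]"
  define t where "t = m - length q div 2"
  have "even (length p)" "even (length q)"
    using bi_parity(2,4)[OF bi x] y by blast+
  then obtain a b where ab: "length p = 2 * a" "length q = 2 * b" by (auto elim!: evenE)
  have t: "2 * t + length q = 2 * m" "1 \<le> t" "t \<le> m" and n: "length P = 2 * m + 2 * t"
    using len le ab m_ge unfolding t_def P_def by auto
  have P: "path f P" using bi by (simp add: bi_def P_def)
  have P_not_q: "P ! i \<notin> set q" if "i < length P" for i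
  proof -
    have "set P \<inter> set q = {}" using bi by (auto simp: bi_def P_def path_Cons path_append)
    then show ?thesis using nth_mem[OF that] by blast
  qed
  have side: "(P ! i \<in> A \<longleftrightarrow> even i) \<and> (P ! i \<in> B \<longleftrightarrow> odd i)" if "i < length P" for i
  proof -
    have "path f (take (Suc i) P)"
      using P append_take_drop_id[of "Suc i" P] path_append by metis
    moreover have "hd (take (Suc i) P) = x" "take (Suc i) P \<noteq> []" by (simp_all add: P_def)
    moreover have "last (take (Suc i) P) = P ! i" using that by (simp add: take_Suc_conv_app_nth)
    moreover have "length (take (Suc i) P) = Suc i" using that by simp
    ultimately show ?thesis
      using alternating(2,3)[of f A B "take (Suc i) P"] f_cross A_B x by (auto simp del: take_Suc)
  qed
  \<comment> \<open>In red, this edge would close a segment of \<open>P\<close> to a cycle with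
    \<open>j - i + 1\<close> vertices.\<close>
  have chord: "g (P ! i) (P ! j)" if ij: "i < j" "j < length P" "odd (j - i)" "2 * m \<le> j - i + 1" for i j
  proof -
    define C where "C = drop i (take (Suc j) P)"
    have "path f (take (Suc j) P)"
      using P append_take_drop_id[of "Suc j" P] path_append by metis
    then have C: "path f C"
      unfolding C_def using append_take_drop_id[of i "take (Suc j) P"] path_append by metis
    have lenC: "length C = j - i + 1" using ij by (simp add: C_def)
    have hdC: "hd C = P ! i" using ij by (simp add: C_def hd_drop_conv_nth)
    have "last C = P ! j"
      using ij by (simp add: C_def take_Suc_conv_app_nth)
    then have "\<not> f (P ! j) (P ! i)"
      using f_short[of C] C lenC hdC ij m_ge unfolding cyc_def by auto
    moreover have "P ! i \<in> A \<and> P ! j \<in> B \<or> P ! i \<in> B \<and> P ! j \<in> A"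
      using side[of i] side[of j] ij by auto
    ultimately show ?thesis using g_iff f_commute g_commute by blast
  qed
  \<comment> \<open>The zigzag goes forward by \<open>2 * m + 1\<close> and back by
    \<open>2 * m - 1\<close>, the least distance that \<open>chord\<close> allows. It keeps
    parities, hence is injective, and ends at the index \<open>2 * m + 2 * t - 1\<close> of
    \<open>y\<close>.\<close>
  define h where "h k = (if even k then k else 2 * m + k)" for k
  define L where "L = map (\<lambda>k. P ! h k) [0..<2 * t]"
  have h_less: "h k < length P" if "k < 2 * t" for k
    using that n t by (auto simp: h_def)
  have "g (P ! h k) (P ! h (Suc k))" if "Suc k < 2 * t" for k
  proof (cases "even k")
    case True
    then show ?thesis
      using that n m_ge chord[of k "2 * m + Suc k"] by (simp add: h_def)
  next
    case False
    then show ?thesis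
      using that n m_ge chord[of "Suc k" "2 * m + k"] g_commute by (simp add: h_def)
  qed
  then have "successively g L"
    by (simp add: successively_conv_nth L_def)
  moreover have "inj_on (\<lambda>k. P ! h k) {0..<2 * t}"
  proof (rule inj_onI)
    fix k l assume kl: "k \<in> {0..<2 * t}" "l \<in> {0..<2 * t}" "P ! h k = P ! h l"
    then have "h k = h l"
      using h_less P nth_eq_iff_index_eq[of P "h k" "h l"] by (simp add: path_def)
    then show "k = l" using kl t by (auto simp: h_def split: if_splits)
  qed
  ultimately have L: "path g L"
    by (simp add: path_def L_def distinct_map)
  have lenL: "length L = 2 * t" "L \<noteq> []" using t by (simp_all add: L_def)
  have hdL: "hd L = x" using t by (simp add: L_def hd_map P_def h_def)
  have "last L = P ! (length P - 1)"
    using t n by (simp add: L_def last_map h_def)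
  then have lastL: "last L = y" by (simp add: P_def nth_append)
  have disj: "set L \<inter> set q = {}"
    using P_not_q h_less by (auto simp: L_def)
  have "cyc g (L @ rev q)"
  proof (cases "q = []")
    case True
    then show ?thesis
      using bi L lenL hdL lastL g_commute t m_ge by (auto simp: bi_def cyc_def path_Cons)
  next
    case False
    have "path g q" "g (last q) y" "g x (hd q)"
      using bi False by (auto simp: bi_def path_Cons path_append)
    then show ?thesis
      using L lenL hdL lastL g_commute t m_ge False disj path_rev[OF g_sym]
      by (intro cyc_append) (auto simp: hd_rev last_rev)
  qed
  moreover have "length (L @ rev q) = 2 * m" using lenL t by simp
  ultimately show False using g_short by fastforce
qed

lemma no_spanning_even:
  assumes bi: "bi f g x p y q" and x: "x \<in> A" and y: "y \<in> B" and len: "length p + length q + 2 = 4 * m"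
  shows False
proof -
  interpret c: bicoloured A B g f m by (rule swap_colours)
  show False
    using no_spanning_even_aux[OF bi x y len] c.no_spanning_even_aux[OF bi_colours[OF bi] x y] len
    by (metis add.commute nle_le)
qed

end

text \<open>While \<open>p\<close> has more than \<open>2 * m - 1\<close> vertices, the edges
  \<open>x r'\<close> and \<open>y r\<close> are blue, since in red they close long cycles. So
  \<open>r\<close> and \<open>r'\<close> can replace \<open>x\<close> and \<open>y\<close>, which
  exchanges the sides, until the case \<open>k = 0\<close> of \<open>cluster\<close> is
  reached.\<close>

lemma no_spanning_odd_aux:
  assumes "bicoloured A B f g m" "bi f g x p y q" "x \<in> A" "y \<in> A"
    and "length p + length q + 2 = 4 * m" "2 * m - 1 \<le> length p"
  shows False
  using assms
proof (induction "length p" arbitrary: A B x p y q rule: less_induct)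
  case less
  interpret bicoloured A B f g m by (rule less.prems)
  note bi = less.prems(2)
  have "odd (length p)" using bi_parity(1)[OF bi less.prems(3)] less.prems(4) by blast
  have p3: "3 \<le> length p" using less.prems(6) m_ge by linarith
  then obtain r p0 r' where p: "p = r # p0 @ [r']"
    by (cases p; cases "tl p" rule: rev_cases) auto
  have fx: "f x r" "f r' y" using bi p by (auto simp: bi_def path_Cons path_append)
  then have r: "r \<in> B" "r' \<in> B" using f_cross less.prems(3,4) A_B by blast+
  show False
  proof (cases "length p = 2 * m - 1")
    case True
    then have q: "length q = 2 * m - 1" using less.prems(5) m_ge by linarith
    then have "q \<noteq> []" using m_ge by auto
    then have gx: "g x (hd q)" "g (last q) y" using bi by (auto simp: bi_def path_Cons path_append)
    then have qB: "hd q \<in> B" "last q \<in> B" using g_cross less.prems(3,4) A_B by blast+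
    have "cluster A B f g m {x} {y} {} {} p q 0"
    proof (intro cluster.intro cluster_axioms.intro)
      show "bicoloured A B f g m" by (rule less.prems)
      show "{x} \<inter> {y} = {}" "set p \<inter> ({x} \<union> {y} \<union> {} \<union> {}) = {}"
        "set q \<inter> ({x} \<union> {y} \<union> {} \<union> {}) = {}" "set p \<inter> set q = {}" "path f p" "path g q"
        using bi by (auto simp: bi_def path_Cons path_append)
      show "hd p \<in> B" "last p \<in> B" using r p by auto
      show "\<exists>a\<in>{x}. f a (hd p)" "\<exists>a\<in>{y}. f a (last p)" using fx f_commute p by auto
      show "\<exists>a\<in>{x}. g a (hd q)" "\<exists>a\<in>{y}. g a (last q)" using gx g_commute by auto
    qed (use True q qB less.prems(3,4) m_ge in auto)
    then show False using no_cluster by blast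
  next
    case False
    then have big: "2 * m + 1 \<le> length p" using less.prems(6) \<open>odd (length p)\<close> by presburger
    have "\<not> f r' x"
    proof
      assume "f r' x"
      then have "cyc f (x # p)"
        using bi p by (auto simp: cyc_def bi_def path_Cons path_append hd_append split: if_splits)
      then show False using f_short big by fastforce
    qed
    moreover have "\<not> f y r"
    proof
      assume "f y r"
      then have "cyc f (p @ [y])"
        using bi p by (auto simp: cyc_def bi_def path_Cons path_append hd_append split: if_splits)
      then show False using f_short big by fastforce
    qed
    ultimately have gr: "g x r'" "g y r"
      using g_iff less.prems(3,4) r f_commute by blast+
    have "path g (y # rev q @ [x])"
      using bi path_rev[OF g_sym, of "x # q @ [y]"] by (simp add: bi_def)
    moreover have "set (y # rev q @ [x]) \<inter> set p = {}"
      using bi by (auto simp: bi_def path_Cons path_append)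
    moreover have "r \<noteq> r'" using bi p by (auto simp: bi_def path_Cons path_append)
    ultimately have "path g (r # (y # rev q @ [x]) @ [r'])"
      using gr g_commute p by (intro path_extend[of g "y # rev q @ [x]"]) auto
    moreover have "path f p" using bi by (simp add: bi_def path_Cons path_append)
    then have "path f (r # p0 @ [r'])" by (simp only: p)
    moreover have "set p0 \<inter> set (y # rev q @ [x]) = {}"
      using \<open>set (y # rev q @ [x]) \<inter> set p = {}\<close> p by auto
    ultimately have new: "bi f g r p0 r' (y # rev q @ [x])"
      by (simp add: bi_def)
    show False
      by (rule less.hyps[OF _ swap_sides new r]) (use p less.prems(5) big in auto)
  qed
qed

section \<open>Longest cycles and the final contradiction\<close>

context bicoloured
begin

lemma no_spanning_odd:
  assumes bi: "bi f g x p y q" and x: "x \<in> A" and y: "y \<in> A" and len: "length p + length q + 2 = 4 * m"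
  shows False
proof -
  consider "2 * m - 1 \<le> length p" | "2 * m - 1 \<le> length q" using len by linarith
  then show False
  proof cases
    case 1
    then show False by (rule no_spanning_odd_aux[OF bicoloured_axioms bi x y len])
  next
    case 2
    then show False
      using no_spanning_odd_aux[OF swap_colours bi_colours[OF bi] x y] len by simp
  qed
qed

lemma no_spanning:
  assumes bi: "bi f g x p y q"
  shows "length p + length q + 2 \<noteq> 4 * m"
proof
  assume len: "length p + length q + 2 = 4 * m"
  interpret s: bicoloured B A f g m by (rule swap_sides)
  have "x \<in> A \<union> B" "y \<in> A \<union> B" using bi_balanced(1)[OF bi] by auto
  then consider "x \<in> A" "y \<in> A" | "x \<in> A" "y \<in> B" | "x \<in> B" "y \<in> A" | "x \<in> B" "y \<in> B" by blast
  then show False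
    using no_spanning_odd[OF bi _ _ len] s.no_spanning_odd[OF bi _ _ len]
      no_spanning_even[OF bi _ _ len] s.no_spanning_even[OF bi _ _ len]
    by cases blast+
qed

text \<open>If \<open>x\<close> is red to \<open>r\<close> and blue to \<open>s\<close>, any other
  vertex of \<open>A\<close> gives a union at once or has these colours reversed; two of the latter
  kind form a union with \<open>r\<close> and \<open>s\<close>. If there is no such
  \<open>x\<close>, then \<open>m\<close> vertices of \<open>A\<close> have one and the same colour
  to all of \<open>B\<close>.\<close>

lemma ex_bi: "\<exists>x p y q. bi f g x p y q"
proof (cases "\<exists>x\<in>A. \<exists>r\<in>B. \<exists>s\<in>B. f x r \<and> g x s")
  case True
  then obtain x r s where xrs: "x \<in> A" "r \<in> B" "s \<in> B" "f x r" "g x s" by blast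
  have rs: "r \<noteq> s" using xrs f_g_excl by blast
  have "\<not> A \<subseteq> {x}" using card_mono[of "{x}" A] card_A m_ge by auto
  then obtain a where a: "a \<in> A" "a \<noteq> x" by blast
  have "\<not> A \<subseteq> {x, a}"
    using card_mono[of "{x, a}" A] card_A m_ge a by auto
  then obtain b where b: "b \<in> A" "b \<noteq> x" "b \<noteq> a" by blast
  have ne: "c \<noteq> r" "c \<noteq> s" if "c \<in> A" for c using that xrs A_B by blast+
  have *: "(\<exists>x p y q. bi f g x p y q) \<or> f c s \<and> g c r" if c: "c \<in> A" "c \<noteq> x" for c
  proof -
    consider "f c r" "g c s" | "g c r" "g c s" | "f c r" "f c s" | "f c s" "g c r"
      using g_iff[OF c(1)] xrs by blast
    then show ?thesis
    proof cases
      case 1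
      then have "bi f g x [r] c [s]"
        using xrs rs ne[OF c(1)] ne[OF xrs(1)] c f_commute g_commute by (auto simp: bi_def path_Cons)
      then show ?thesis by blast
    next
      case 2
      then have "bi f g x [] r [s, c]"
        using xrs rs ne[OF c(1)] ne[OF xrs(1)] c f_commute g_commute by (auto simp: bi_def path_Cons)
      then show ?thesis by blast
    next
      case 3
      then have "bi f g x [r, c] s []"
        using xrs rs ne[OF c(1)] ne[OF xrs(1)] c f_commute g_commute by (auto simp: bi_def path_Cons)
      then show ?thesis by blast
    qed blast
  qed
  show ?thesis
  proof (rule ccontr)
    assume none: "\<not> (\<exists>x p y q. bi f g x p y q)"
    then have "f a s" "g a r" "f b s" "g b r" using * a b by blast+
    then have "bi f g a [s] b [r]"
      using rs ne[OF a(1)] ne[OF b(1)] b f_commute g_commute by (auto simp: bi_def path_Cons)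
    then show False using none by blast
  qed
next
  case False
  interpret c: bicoloured A B g f m by (rule swap_colours)
  define F where "F = {x \<in> A. \<forall>r\<in>B. f x r}"
  define G where "G = {x \<in> A. \<forall>r\<in>B. g x r}"
  have "A = F \<union> G" using False g_iff unfolding F_def G_def by blast
  then have "card A \<le> card F + card G" by (metis card_Un_le)
  then consider "m \<le> card F" | "m \<le> card G" using card_A by linarith
  then show ?thesis
  proof cases
    case 1
    have False
      by (rule no_complete[of F B]) (use 1 card_B in \<open>auto simp: F_def\<close>)
    then show ?thesis ..
  next
    case 2
    have False
      by (rule c.no_complete[of G B]) (use 2 card_B in \<open>auto simp: G_def\<close>)
    then show ?thesis ..
  qed
qed

text \<open>At least \<open>m\<close> vertices of each side lie outside \<open>zs\<close>, so some
  outside edge \<open>u w\<close> is blue by \<open>no_complete\<close>. Whatever the colours of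
  \<open>u b\<close> and \<open>a w\<close>, replacing the edge \<open>b a\<close> by the detour
  through \<open>u\<close> and \<open>w\<close> gives a union with two more vertices.\<close>

lemma cyc_not_max_A:
  assumes bi_max: "\<And>x p y q. bi f g x p y q \<Longrightarrow> length p + length q + 2 \<le> length zs"
    and zs: "cyc f zs" and hd: "hd zs \<in> A"
  shows False
proof -
  obtain a p b where p: "zs = a # p @ [b]"
    using zs unfolding cyc_def by (cases zs; cases "tl zs" rule: rev_cases) auto
  have path: "path f (a # p @ [b])" and ba: "f b a"
    using zs p by (auto simp: cyc_def)
  have a: "a \<in> A" and b: "b \<in> B"
    using hd p f_cross[OF ba] A_B by auto
  have "zs \<noteq> []" using p by simp
  then have "card (set zs \<inter> A) = (length zs + 1) div 2" "card (set zs \<inter> B) = length zs div 2"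
    "even (length zs)"
    using alternating(3-5)[of f A B zs] f_cross A_B path p hd b by auto
  then have "card (set zs \<inter> A) < m" "card (set zs \<inter> B) < m"
    using f_short[OF zs] by (auto elim!: evenE)
  then have "m \<le> card (A - set zs)" "m \<le> card (B - set zs)"
    using card_A card_B by (simp_all add: card_Diff_subset_Int Int_commute)
  moreover have "f u w" if u: "u \<in> A - set zs" and w: "w \<in> B - set zs" for u w
  proof (rule ccontr)
    assume "\<not> f u w"
    then have uw: "g u w" "g w u" using u w g_iff g_commute by blast+
    have "path f (rev (a # p @ [b]))" using path path_rev[OF f_sym] by blast
    then have rpath: "path f (b # rev p @ [a])" by simp
    have ne: "u \<noteq> w" "u \<notin> set p" "w \<notin> set p" "u \<noteq> a" "u \<noteq> b" "w \<noteq> a" "w \<noteq> b"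
      using u w p A_B by auto
    have ab: "a \<noteq> b" using a b A_B by blast
    have c: "f u b \<or> g u b" "f a w \<or> g a w" using u w a b g_iff by blast+
    consider "f u b" "f a w" | "f u b" "g a w" | "g u b" "f a w" | "g u b" "g a w" using c by blast
    then show False
    proof cases
      case 1
      then have "bi f g u (b # rev p @ [a]) w []"
        using rpath ne uw ab by (auto simp: bi_def path_Cons path_append hd_append)
      then show False using bi_max[of u _ w "[]"] p by fastforce
    next
      case 2
      then have "bi f g u (b # rev p) a [w]"
        using rpath ne uw ab g_commute by (auto simp: bi_def path_Cons path_append hd_append)
      then show False using bi_max[of u _ a "[w]"] p by fastforce
    next
      case 3
      then have "bi f g w (a # p) b [u]"
        using path ne uw ab f_commute by (auto simp: bi_def path_Cons path_append hd_append)
      then show False using bi_max[of w _ b "[u]"] p by fastforce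
    next
      case 4
      then have "bi f g a p b [w, u]"
        using path ne uw ab g_commute by (auto simp: bi_def path_Cons path_append hd_append)
      then show False using bi_max[of a _ b "[w, u]"] p by fastforce
    qed
  qed
  ultimately show False
    using no_complete[of "A - set zs" "B - set zs"] by auto
qed

lemma cyc_not_max:
  assumes bi_max: "\<And>x p y q. bi f g x p y q \<Longrightarrow> length p + length q + 2 \<le> length zs"
  shows "\<not> cyc f zs"
proof
  assume zs: "cyc f zs"
  interpret s: bicoloured B A f g m by (rule swap_sides)
  have "f (last zs) (hd zs)" using zs by (simp add: cyc_def)
  then consider "hd zs \<in> A" | "hd zs \<in> B" using f_cross by blast
  then show False
    by cases (rule cyc_not_max_A[OF _ zs], rule bi_max, assumption+,
        rule s.cyc_not_max_A[OF _ zs], rule bi_max, assumption+)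
qed

lemma contradiction: False
proof -
  interpret c: bicoloured A B g f m by (rule swap_colours)
  \<comment> \<open>The maximum is taken over unions and monochromatic cycles together; by
    \<open>cyc_not_max\<close> only unions attain it.\<close>
  define S where "S n \<longleftrightarrow> (\<exists>x p y q. bi f g x p y q \<and> n = length p + length q + 2) \<or>
    (\<exists>xs. (cyc f xs \<or> cyc g xs) \<and> n = length xs)" for n
  have bound: "n \<le> 4 * m" if "S n" for n
  proof -
    have "length p + length q + 2 \<le> 4 * m" if bi: "bi f g x p y q" for x p y q
    proof -
      have "card (verts x p y q \<inter> A) \<le> card A" by (simp add: card_mono)
      then show ?thesis using bi_balanced(3)[OF bi] card_A by linarith
    qed
    then show ?thesis using that f_short g_short unfolding S_def by fastforce
  qed
  obtain k where "S k" using ex_bi unfolding S_def by blast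
  then obtain M where M: "S M" "\<And>n. S n \<Longrightarrow> n \<le> M"
    using Nat.ex_has_greatest_nat[of S k "4 * m"] bound by blast
  have bi_max: "length p + length q + 2 \<le> M" if "bi f g x p y q" for x p y q
    using that M(2) unfolding S_def by blast
  have c_max: "length xs \<le> M" if "cyc f xs \<or> cyc g xs" for xs
    using that M(2) unfolding S_def by blast
  have bi_max': "length p + length q + 2 \<le> M" if "bi g f x p y q" for x p y q
    using bi_max[OF bi_colours[OF that]] by simp
  have ne: "length xs \<noteq> M" if "cyc f xs \<or> cyc g xs" for xs
    using that cyc_not_max[of xs] c.cyc_not_max[of xs] bi_max bi_max' by blast
  interpret maximal A B f g m M
    by unfold_locales (use bi_max c_max ne le_neq_implies_less in blast)+
  obtain x p y q where "bi f g x p y q" "length p + length q + 2 = M"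
    using M(1) ne unfolding S_def by metis
  then show False using spans no_spanning by blast
qed

end

subsection \<open>Two-edge-colourings of complete bipartite graphs\<close>

text \<open>The index \<open>Suc i mod length vs\<close> wraps around only at the last vertex, which
  gives the closing edge of \<open>cyc\<close>.\<close>

lemma is_cycle_iff_cyc: "is_cycle E vs \<longleftrightarrow> cyc (\<lambda>u v. {u, v} \<in> E) vs"
proof (cases "3 \<le> length vs")
  case True
  have "cycle_edges vs \<subseteq> E \<longleftrightarrow>
    (\<forall>i. Suc i < length vs \<longrightarrow> {vs ! i, vs ! Suc i} \<in> E) \<and> {last vs, hd vs} \<in> E" (is "?L \<longleftrightarrow> ?R")
  proof
    assume L: ?L
    have edge: "{vs ! i, vs ! (Suc i mod length vs)} \<in> E" if "i < length vs" for i
      using L that unfolding cycle_edges_def by blast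
    show ?R
    proof (intro conjI allI impI)
      show "{vs ! i, vs ! Suc i} \<in> E" if "Suc i < length vs" for i
        using edge[of i] that by simp
      have "vs \<noteq> []" using True by auto
      then show "{last vs, hd vs} \<in> E"
        using edge[of "length vs - 1"] by (simp add: last_conv_nth hd_conv_nth)
    qed
  next
    assume R: ?R
    have ne: "vs \<noteq> []" using True by auto
    have "{vs ! i, vs ! (Suc i mod length vs)} \<in> E" if "i < length vs" for i
    proof (cases "Suc i = length vs")
      case True
      then have "i = length vs - 1" by simp
      then show ?thesis
        using R ne True by (simp add: last_conv_nth hd_conv_nth)
    next
      case False
      then show ?thesis using R that by simp
    qed
    then show ?L unfolding cycle_edges_def by blast
  qed
  then show ?thesis
    using True by (auto simp: is_cycle_def cyc_def path_def successively_conv_nth)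
qed (simp add: is_cycle_def cyc_def)

lemma cyc_mono:
  assumes "cyc f vs" "\<And>u v. f u v \<Longrightarrow> f' u v"
  shows "cyc f' vs"
  using assms successively_mono[of f vs f'] by (auto simp: cyc_def path_def)

lemma long_cycle_exists:
  assumes col: "two_edge_coloring (complete_bipartite_edges n n) E\<^sub>R E\<^sub>B" and n: "6 \<le> n"
  shows "\<exists>vs. monochromatic_cycle E\<^sub>R E\<^sub>B vs \<and> 2 * (n div 2) \<le> length vs"
proof (rule ccontr)
  assume none: "\<not> ?thesis"
  \<comment> \<open>For odd \<open>n\<close> one vertex of each side is dropped;
    \<open>6 \<le> n\<close> ensures \<open>3 \<le> m\<close>.\<close>
  define m where "m = n div 2"
  define A :: "(nat + nat) set" where "A = Inl ` {..<2 * m}"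
  define B :: "(nat + nat) set" where "B = Inr ` {..<2 * m}"
  define cross where "cross u v \<longleftrightarrow> u \<in> A \<and> v \<in> B \<or> u \<in> B \<and> v \<in> A" for u v
  define f where "f u v \<longleftrightarrow> cross u v \<and> {u, v} \<in> E\<^sub>R" for u v
  \<comment> \<open>Edges with both colours count as red only, so that \<open>f\<close> and
    \<open>g\<close> are complementary.\<close>
  define g where "g u v \<longleftrightarrow> cross u v \<and> {u, v} \<notin> E\<^sub>R" for u v
  have n2: "2 * m \<le> n" by (simp add: m_def)
  have g_blue: "{u, v} \<in> E\<^sub>B" if "g u v" for u v
  proof -
    have "{u, v} \<in> complete_bipartite_edges n n"
      using that n2 unfolding g_def cross_def A_def B_def complete_bipartite_edges_def by fastforce
    then show ?thesis
      using that col by (auto simp: g_def two_edge_coloring_def)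
  qed
  have "bicoloured A B f g m"
  proof
    show "card A = 2 * m" "card B = 2 * m"
      by (simp_all add: A_def B_def card_image)
    show "3 \<le> m" using n by (simp add: m_def)
    show AB: "A \<inter> B = {}" by (auto simp: A_def B_def)
    show "symp f" "symp g"
      by (auto simp: f_def g_def cross_def symp_def insert_commute)
    show "g a b \<longleftrightarrow> \<not> f a b" if "a \<in> A" "b \<in> B" for a b
      using that by (auto simp: f_def g_def cross_def)
    show "length xs < 2 * m" if "cyc f xs" for xs
    proof -
      have "is_cycle E\<^sub>R xs"
        using cyc_mono[OF that, of "\<lambda>u v. {u, v} \<in> E\<^sub>R"] by (simp add: is_cycle_iff_cyc f_def)
      then show ?thesis
        using none by (auto simp: monochromatic_cycle_def m_def not_le)
    qed
    show "length xs < 2 * m" if "cyc g xs" for xs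
    proof -
      have "is_cycle E\<^sub>B xs"
        using cyc_mono[OF that, of "\<lambda>u v. {u, v} \<in> E\<^sub>B"] g_blue by (simp add: is_cycle_iff_cyc)
      then show ?thesis
        using none by (auto simp: monochromatic_cycle_def m_def not_le)
    qed
  qed (simp_all add: f_def g_def cross_def)
  then show False by (rule bicoloured.contradiction)
qed

section \<open>The extremal colouring\<close>

lemma cyc_balanced:
  assumes cross: "\<And>u v. f u v \<Longrightarrow> u \<in> A \<and> v \<in> B \<or> u \<in> B \<and> v \<in> A" and AB: "A \<inter> B = {}"
    and vs: "cyc f vs"
  shows "length vs = 2 * card (set vs \<inter> B)"
proof -
  have p: "path f vs" "vs \<noteq> []" and close: "f (last vs) (hd vs)"
    using vs by (auto simp: cyc_def)
  consider "hd vs \<in> A" "last vs \<in> B" | "hd vs \<in> B" "last vs \<in> A"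
    using cross[OF close] by blast
  then show ?thesis
  proof cases
    case 1
    then show ?thesis
      using alternating(3,5)[of f A B vs] cross AB p by auto
  next
    case 2
    have "u \<in> B \<and> v \<in> A \<or> u \<in> A \<and> v \<in> B" if "f u v" for u v
      using cross[OF that] by blast
    then show ?thesis
      using alternating(3,4)[of f B A vs] AB p 2 by (auto simp: Int_commute elim!: evenE)
  qed
qed

text \<open>After removing the vertex \<open>c\<close>, a cycle stays within one class of \<open>\<kappa>\<close>.\<close>

lemma cyc_length_le:
  assumes cross: "\<And>u v. f u v \<Longrightarrow> u \<in> A \<and> v \<in> B \<or> u \<in> B \<and> v \<in> A" and AB: "A \<inter> B = {}"
    and f: "symp f" and c: "c \<in> A"
    and same: "\<And>u v. f u v \<Longrightarrow> u \<noteq> c \<Longrightarrow> v \<noteq> c \<Longrightarrow> \<kappa> u = \<kappa> v"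
    and small: "\<And>k. finite {b \<in> B. \<kappa> b = k \<and> (\<exists>v. v \<noteq> c \<and> f b v)} \<and>
      card {b \<in> B. \<kappa> b = k \<and> (\<exists>v. v \<noteq> c \<and> f b v)} \<le> m"
    and vs: "cyc f vs"
  shows "length vs \<le> 2 * m"
proof -
  obtain ws where ws: "path f ws" "2 \<le> length ws" "c \<notin> set ws" "set vs \<subseteq> insert c (set ws)"
  proof (cases "c \<in> set vs")
    case True
    then obtain xs ys where "vs = xs @ c # ys" by (metis split_list)
    then have "cyc f (c # ys @ xs)" using cyc_rotate[of f xs "c # ys"] vs by simp
    then show ?thesis
      using that[of "ys @ xs"] \<open>vs = xs @ c # ys\<close> by (auto simp: cyc_def path_Cons)
  next
    case False
    then show ?thesis using that[of vs] vs by (auto simp: cyc_def)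
  qed
  have const: "\<kappa> v = \<kappa> (hd us)" if "path f us" "c \<notin> set us" "v \<in> set us" for us v
    using that
  proof (induction us)
    case (Cons u us)
    then show ?case
      by (cases us) (auto simp: path_Cons dest: same)
  qed simp
  \<comment> \<open>The sets in \<open>small\<close> demand a neighbour other than \<open>c\<close>;
    in the applications this discards vertices without edges or joined to \<open>c\<close>
    only.\<close>
  have nbr: "\<exists>w\<in>set us. f v w" if "path f us" "2 \<le> length us" "v \<in> set us" for us v
    using that
  proof (induction us)
    case (Cons u us)
    then have us: "us \<noteq> []" "f u (hd us)" "path f us" by (auto simp: path_Cons)
    show ?case
    proof (cases "2 \<le> length us \<and> v \<in> set us")
      case True
      then show ?thesis using Cons us by auto
    next
      case False
      then have "v = u \<or> us = [v]" using Cons.prems us(1) by (cases us) (auto simp: Suc_le_eq)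
      then show ?thesis using us f by (auto simp: symp_def)
    qed
  qed simp
  have "set vs \<inter> B \<subseteq> {b \<in> B. \<kappa> b = \<kappa> (hd ws) \<and> (\<exists>v. v \<noteq> c \<and> f b v)}"
  proof
    fix b assume b: "b \<in> set vs \<inter> B"
    then have bw: "b \<in> set ws" using ws(4) c AB by blast
    obtain w where "w \<in> set ws" "f b w" using nbr[OF ws(1,2) bw] ..
    then show "b \<in> {b \<in> B. \<kappa> b = \<kappa> (hd ws) \<and> (\<exists>v. v \<noteq> c \<and> f b v)}"
      using b const[OF ws(1,3) bw] ws(3) by auto
  qed
  then have "card (set vs \<inter> B) \<le> m"
    using small[of "\<kappa> (hd ws)"] card_mono le_trans by blast
  then show ?thesis using cyc_balanced[OF cross AB vs] by simp
qed

text \<open>The first \<open>2 * (n div 2)\<close> vertices of each side are halved; red joins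
  corresponding halves and blue opposite ones. For odd \<open>n\<close> the extra right vertex is
  blue to everything, and the extra left vertex is red to all other right vertices.\<close>

definition red_edges :: "nat \<Rightarrow> (nat + nat) set set" where
  "red_edges n = {{Inl i, Inr j} | i j. i < n \<and> j < 2 * (n div 2) \<and>
     (i = 2 * (n div 2) \<or> (i < n div 2 \<longleftrightarrow> j < n div 2))}"

definition blue_edges :: "nat \<Rightarrow> (nat + nat) set set" where
  "blue_edges n = {{Inl i, Inr j} | i j. i < n \<and> j < n \<and>
     (j = 2 * (n div 2) \<or> i < 2 * (n div 2) \<and> (i < n div 2 \<longleftrightarrow> \<not> j < n div 2))}"

lemma two_edge_coloring_red_blue:
  "two_edge_coloring (complete_bipartite_edges n n) (red_edges n) (blue_edges n)"
proof -
  have *: "i < 2 * (n div 2) \<or> i = 2 * (n div 2)" if "i < n" for i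
    using that by linarith
  have "2 * (n div 2) \<le> n" by simp
  then have "i < n" if "i < 2 * (n div 2)" for i using that by linarith
  with * show ?thesis
    unfolding two_edge_coloring_def complete_bipartite_edges_def red_edges_def blue_edges_def
    by (intro equalityI subsetI) blast+
qed

lemma card_half:
  "finite {j. j < 2 * m \<and> (j < m) = k} \<and> card {j. j < 2 * m \<and> (j < m) = k} \<le> (m :: nat)"
proof (cases k)
  case True
  then have "{j. j < 2 * m \<and> (j < m) = k} = {..<m}" by auto
  then show ?thesis by simp
next
  case False
  then have "{j. j < 2 * m \<and> (j < m) = k} = {m..<2 * m}" by auto
  then show ?thesis by simp
qed

lemma red_cycle_le:
  assumes "is_cycle (red_edges n) vs"
  shows "length vs \<le> 2 * (n div 2)"
proof (rule cyc_length_le[where c = "Inl (2 * (n div 2))" and A = "range Inl" and B = "range Inr"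
      and \<kappa> = "case_sum (\<lambda>i. i < n div 2) (\<lambda>j. j < n div 2)"])
  show "cyc (\<lambda>u v. {u, v} \<in> red_edges n) vs"
    using assms by (simp add: is_cycle_iff_cyc)
  fix k
  let ?N = "{b \<in> range Inr. case_sum (\<lambda>i. i < n div 2) (\<lambda>j. j < n div 2) b = k \<and>
    (\<exists>v. v \<noteq> Inl (2 * (n div 2)) \<and> {b, v} \<in> red_edges n)}"
  have "?N \<subseteq> Inr ` {j. j < 2 * (n div 2) \<and> (j < n div 2) = k}"
    by (auto simp: red_edges_def doubleton_eq_iff)
  then show "finite ?N \<and> card ?N \<le> n div 2"
    using card_half[of "n div 2" k] surj_card_le[of "{j. j < 2 * (n div 2) \<and> (j < n div 2) = k}" ?N Inr]
    by (meson finite_imageI finite_subset le_trans)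
qed (auto simp: red_edges_def doubleton_eq_iff symp_def insert_commute)

text \<open>The right-hand classes are negated because blue joins opposite halves. The extra left
  vertex is not counted, since its only possible blue neighbour is the removed vertex.\<close>

lemma blue_cycle_le:
  assumes "is_cycle (blue_edges n) vs"
  shows "length vs \<le> 2 * (n div 2)"
proof (rule cyc_length_le[where c = "Inr (2 * (n div 2))" and A = "range Inr" and B = "range Inl"
      and \<kappa> = "case_sum (\<lambda>i. i < n div 2) (\<lambda>j. \<not> j < n div 2)"])
  show "cyc (\<lambda>u v. {u, v} \<in> blue_edges n) vs"
    using assms by (simp add: is_cycle_iff_cyc)
  fix k
  let ?N = "{b \<in> range Inl. case_sum (\<lambda>i. i < n div 2) (\<lambda>j. \<not> j < n div 2) b = k \<and>
    (\<exists>v. v \<noteq> Inr (2 * (n div 2)) \<and> {b, v} \<in> blue_edges n)}"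
  have "?N \<subseteq> Inl ` {j. j < 2 * (n div 2) \<and> (j < n div 2) = k}"
    by (auto simp: blue_edges_def doubleton_eq_iff)
  then show "finite ?N \<and> card ?N \<le> n div 2"
    using card_half[of "n div 2" k] surj_card_le[of "{j. j < 2 * (n div 2) \<and> (j < n div 2) = k}" ?N Inl]
    by (meson finite_imageI finite_subset le_trans)
qed (auto simp: blue_edges_def doubleton_eq_iff symp_def insert_commute)

theorem corollary1p6:
  shows "\<exists>n\<^sub>0 :: nat. \<forall>n \<ge> n\<^sub>0.
    (\<forall>E\<^sub>R E\<^sub>B. two_edge_coloring (complete_bipartite_edges n n) E\<^sub>R E\<^sub>B \<longrightarrow>
       (\<exists>vs. monochromatic_cycle E\<^sub>R E\<^sub>B vs \<and> length vs \<ge> 2 * (n div 2))) \<and>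
    (\<exists>E\<^sub>R E\<^sub>B. two_edge_coloring (complete_bipartite_edges n n) E\<^sub>R E\<^sub>B \<and>
       (\<exists>vs. monochromatic_cycle E\<^sub>R E\<^sub>B vs \<and> length vs = 2 * (n div 2)) \<and>
       (\<forall>vs. monochromatic_cycle E\<^sub>R E\<^sub>B vs \<longrightarrow> length vs \<le> 2 * (n div 2)))"
proof (intro exI[of _ 6] allI impI conjI)
  fix n :: nat and E\<^sub>R E\<^sub>B
  assume "6 \<le> n" "two_edge_coloring (complete_bipartite_edges n n) E\<^sub>R E\<^sub>B"
  then show "\<exists>vs. monochromatic_cycle E\<^sub>R E\<^sub>B vs \<and> length vs \<ge> 2 * (n div 2)"
    by (rule long_cycle_exists[rotated])
next
  fix n :: nat
  assume n: "6 \<le> n"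
  have le: "length vs \<le> 2 * (n div 2)" if "monochromatic_cycle (red_edges n) (blue_edges n) vs" for vs
    using that red_cycle_le blue_cycle_le unfolding monochromatic_cycle_def by blast
  \<comment> \<open>The lower bound, applied to the extremal colouring itself, yields a cycle
    attaining the maximum.\<close>
  obtain vs where "monochromatic_cycle (red_edges n) (blue_edges n) vs" "2 * (n div 2) \<le> length vs"
    using long_cycle_exists[OF two_edge_coloring_red_blue n] by blast
  with le show "\<exists>E\<^sub>R E\<^sub>B. two_edge_coloring (complete_bipartite_edges n n) E\<^sub>R E\<^sub>B \<and>
       (\<exists>vs. monochromatic_cycle E\<^sub>R E\<^sub>B vs \<and> length vs = 2 * (n div 2)) \<and>
       (\<forall>vs. monochromatic_cycle E\<^sub>R E\<^sub>B vs \<longrightarrow> length vs \<le> 2 * (n div 2))"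
    using two_edge_coloring_red_blue le_antisym by blast
qed

end
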